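(* Let $p,q\ge 1$ and let $(X^{(1)},\dots,X^{(p)},Y^{(1)},\dots,Y^{(q)},R^{(1)},\dots,R^{(q)})$ be a random vector with real components such that each $R^{(v)}$ takes values in $\{0,1\}$ and $\mathbf{E}\big((X^{(u)})^2\big)<\infty$ for $u=1,\dots,p$. Assume the data are missing completely at random (MCAR), i.e. the random vector $(R^{(1)},\dots,R^{(q)})$ is independent of $(X^{(1)},\dots,X^{(p)},Y^{(1)},\dots,Y^{(q)})$. Let $(X_i^{(1)},\dots,X_i^{(p)},Y_i^{(1)},\dots,Y_i^{(q)},R_i^{(1)},\dots,R_i^{(q)})$, $i=1,2,\dots$, be IID copies of this vector, and for $n\ge 2$, $u\in\{1,\dots,p\}$, $v\in\{1,\dots,q\}$ put $$T_n^{(u,v)}=\frac{1}{n(n-1)}\sum_{i=1}^n\sum_{\substack{j=1\\ j\ne i}}^n X_i^{(u)}R_j^{(v)}-\frac1n\sum_{i=1}^n X_i^{(u)}R_i^{(v)}.$$ Then, as $n\to\infty$, $$\left(\sqrt n\,T_n^{(1,1)},\dots,\sqrt n\,T_n^{(1,q)},\sqrt n\,T_n^{(2,1)},\dots,\sqrt n\,T_n^{(2,q)},\dots,\sqrt n\,T_n^{(p,1)},\dots,\sqrt n\,T_n^{(p,q)}\right)\overset{D}{\to}\mathcal N(\boldsymbol 0,\boldsymbol\Sigma),$$ where $\boldsymbol\Sigma$ is the $pq\times pq$ matrix whose entry in the row corresponding to $(u,v)$ and the column corresponding to $(u',v')$ (indices in the same lexicographic order as in the vector) equals $$\mathbf{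Cov}\left(X^{(u)},X^{(u')}\right)\,\mathbf{Cov}\left(R^{(v)},R^{(v')}\right).$$
   Context: The variables $X^{(u)}$ are completely observed; the variables $Y^{(v)}$ may be missing, and $R^{(v)}$ is the response indicator of $Y^{(v)}$ ($R^{(v)}=1$ if $Y^{(v)}$ is observed, $0$ otherwise). $\overset{D}{\to}$ denotes convergence in distribution, and $\mathcal N(\boldsymbol 0,\boldsymbol\Sigma)$ is the (possibly degenerate) multivariate normal distribution with mean zero and covariance matrix $\boldsymbol\Sigma$. *)

theory Defs
  imports "HOL-Probability.Probability"
begin

definition covariance :: "'a measure \<Rightarrow> ('a \<Rightarrow> real) \<Rightarrow> ('a \<Rightarrow> real) \<Rightarrow> real" where
  "covariance M U V =
     (\<integral>\<omega>. (U \<omega> - (\<integral>\<xi>. U \<xi> \<partial>M)) * (V \<omega> - (\<integral>\<xi>. V \<xi> \<partial>M)) \<partial>M)"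

text \<open>
  A law is normal with mean \<open>\<mu>\<close> and covariance matrix \<open>\<Sigma>\<close> if it is the law of
  \<open>\<mu> + A Z\<close>, where \<open>Z\<close> has independent standard normal components and
  \<open>A A\<^sup>T = \<Sigma>\<close>. The matrix \<open>A\<close> may be singular, so degenerate laws are included. Such an \<open>A\<close>
  exists iff \<open>\<Sigma>\<close> is symmetric and positive semidefinite, and the law does not depend on its choice.
\<close>

definition is_multivariate_normal ::
  "real ^ 'k \<Rightarrow> real ^ 'k ^ 'k \<Rightarrow> (real ^ 'k) measure \<Rightarrow> bool" where
  "is_multivariate_normal \<mu> \<Sigma> N \<longleftrightarrow>
     (\<exists>A :: real ^ 'k ^ 'k. A ** transpose A = \<Sigma> \<and>
        N = distr (\<Pi>\<^sub>M i\<in>(UNIV :: 'k set). density lborel std_normal_density) borel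
              (\<lambda>z. \<mu> + A *v (\<chi> i. z i)))"

text \<open>
  The library notion \<open>weak_conv_m\<close> is restricted to measures on the real line.
\<close>

definition converges_in_distribution ::
  "'a measure \<Rightarrow> (nat \<Rightarrow> 'a \<Rightarrow> 'b :: real_normed_vector) \<Rightarrow> 'b measure \<Rightarrow> bool" where
  "converges_in_distribution M Z N \<longleftrightarrow>
     (\<forall>f :: 'b \<Rightarrow> real. continuous_on UNIV f \<and> bounded (range f) \<longrightarrow>
        (\<lambda>n. \<integral>x. f x \<partial>(distr M borel (Z n))) \<longlonglongrightarrow> (\<integral>x. f x \<partial>N))"

text \<open>
  The library's \<open>indep_var\<close> requires both variables to have the same type, so independence of
  \<open>R\<close> and \<open>(X, Y)\<close> is expressed by independence of the generated \<open>\<sigma>\<close>-algebras, which is what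
  \<open>indep_var\<close> unfolds to.
\<close>

definition MCAR ::
  "'a measure \<Rightarrow> ('a \<Rightarrow> real ^ 'p) \<Rightarrow> ('a \<Rightarrow> real ^ 'q) \<Rightarrow> ('a \<Rightarrow> real ^ 'q) \<Rightarrow> bool" where
  "MCAR M X Y R \<longleftrightarrow>
     R \<in> borel_measurable M \<and> (\<lambda>\<omega>. (X \<omega>, Y \<omega>)) \<in> borel_measurable M \<and>
     prob_space.indep_set M
       {R -` B \<inter> space M | B. B \<in> sets borel}
       {(\<lambda>\<omega>. (X \<omega>, Y \<omega>)) -` C \<inter> space M | C. C \<in> sets borel}"

text \<open>
  \<open>x i\<close> and \<open>r i\<close> are the values of \<open>X\<^sub>i\<close> and \<open>R\<^sub>i\<close>; the sample is indexed from 1. The definition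
  is meaningful for \<open>n \<ge> 2\<close>.
\<close>

definition T_stat ::
  "(nat \<Rightarrow> real ^ 'p) \<Rightarrow> (nat \<Rightarrow> real ^ 'q) \<Rightarrow> nat \<Rightarrow> 'p \<Rightarrow> 'q \<Rightarrow> real" where
  "T_stat x r n u v =
     1 / (real n * (real n - 1)) * (\<Sum>i=1..n. \<Sum>j\<in>{1..n} - {i}. x i $ u * r j $ v)
     - 1 / real n * (\<Sum>i=1..n. x i $ u * r i $ v)"

end

theory Submission
  imports Defs "HOL-Real_Asymp.Real_Asymp"
begin

text \<open>
  Centering \<open>X\<close> and \<open>R\<close> at their means does not change \<open>T\<^sub>n\<close>, and
  \<open>(n - 1) T\<^sub>n = (\<Sum>i. X\<^sub>i) (\<Sum>i. R\<^sub>i) / n - (\<Sum>i. X\<^sub>i R\<^sub>i)\<close> for the centered variables. So \<open>\<surd>n T\<^sub>n\<close> differs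
  from the normalized sum of the IID vectors \<open>\<xi>\<^sub>i = - X\<^sub>i R\<^sub>i\<close> by a term that tends to 0 in \<open>L\<^sup>1\<close>. By MCAR,
  \<open>\<xi>\<^sub>i\<close> has mean 0 and the product covariance.

  The multivariate central limit theorem comes from the one-dimensional one: it gives the limit of
  \<open>E cos (t \<bullet> Z\<^sub>n + b)\<close>, hence of \<open>E g(Z\<^sub>n)\<close> for trigonometric polynomials \<open>g\<close>. A bounded
  continuous function is close to such a \<open>g\<close> up to an error controlled by first absolute moments, so
  boundedness in \<open>L\<^sup>1\<close> takes the role of tightness.
\<close>

subsection \<open>Factorization of positive semidefinite matrices\<close>

text \<open>Cholesky factorization by induction on the index set. Functions on a finite set
  \<open>I\<close> take the place of matrices, because the Schur complement lives on a smaller index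
  set while a matrix type has a fixed one.\<close>

lemma psd_gram_representation:
  fixes S :: "'k \<Rightarrow> 'k \<Rightarrow> real"
  assumes "finite I" and "\<And>k l. S k l = S l k"
    and "\<And>x. 0 \<le> (\<Sum>k\<in>I. \<Sum>l\<in>I. x k * x l * S k l)"
  shows "\<exists>B :: 'k \<Rightarrow> 'k \<Rightarrow> real. \<forall>k\<in>I. \<forall>l\<in>I. (\<Sum>m\<in>I. B k m * B l m) = S k l"
  using assms
proof (induction I arbitrary: S rule: finite_induct)
  case empty
  then show ?case by simp
next
  case (insert j I)
  have expand: "(\<Sum>k\<in>insert j I. \<Sum>l\<in>insert j I. y k * y l * S k l)
      = (y j)\<^sup>2 * S j j + 2 * y j * (\<Sum>k\<in>I. y k * S k j) + (\<Sum>k\<in>I. \<Sum>l\<in>I. y k * y l * S k l)" for y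
  proof -
    have "(\<Sum>l\<in>I. y j * y l * S j l) = y j * (\<Sum>k\<in>I. y k * S k j)"
      by (simp add: sum_distrib_left mult.assoc insert.prems(1)[of j])
    moreover have "(\<Sum>k\<in>I. y k * y j * S k j) = y j * (\<Sum>k\<in>I. y k * S k j)"
      by (simp add: sum_distrib_left mult_ac)
    ultimately show ?thesis
      using insert.hyps by (simp add: sum.distrib power2_eq_square)
  qed
  \<comment> \<open>Setting coordinate \<open>j\<close> to \<open>t\<close> turns the form into a
    quadratic polynomial in the free parameter \<open>t\<close>; semidefiniteness enters below only
    as nonnegativity of this polynomial.\<close>
  have nonneg: "0 \<le> t\<^sup>2 * S j j + 2 * t * (\<Sum>k\<in>I. x k * S k j) + (\<Sum>k\<in>I. \<Sum>l\<in>I. x k * x l * S k l)" for t x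
  proof -
    have *: "k \<noteq> j" if "k \<in> I" for k using that insert.hyps by blast
    have e: "(\<Sum>k\<in>I. (x(j := t)) k * S k j) = (\<Sum>k\<in>I. x k * S k j)"
      "(\<Sum>k\<in>I. \<Sum>l\<in>I. (x(j := t)) k * (x(j := t)) l * S k l) = (\<Sum>k\<in>I. \<Sum>l\<in>I. x k * x l * S k l)"
      by (auto intro!: sum.cong simp: *)
    show ?thesis
      using insert.prems(2)[of "x(j := t)"] unfolding expand e by simp
  qed
  have Sjj: "0 \<le> S j j"
    using nonneg[of 1 "\<lambda>_. 0"] by simp
  have linear_zero: "(\<Sum>k\<in>I. x k * S k j) = 0" if "S j j = 0" for x
  proof (rule ccontr)
    let ?d = "\<Sum>k\<in>I. x k * S k j" and ?Q = "\<Sum>k\<in>I. \<Sum>l\<in>I. x k * x l * S k l"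
    assume "?d \<noteq> 0"
    \<comment> \<open>If \<open>S j j = 0\<close>, the polynomial is affine in \<open>t\<close>;
      with a nonzero slope it takes the value -1 at this \<open>t\<close>.\<close>
    define t where "t = - (?Q + 1) / (2 * ?d)"
    have "2 * t * ?d = - (?Q + 1)"
      using \<open>?d \<noteq> 0\<close> by (simp add: t_def)
    then show False
      using nonneg[of t x] that by simp
  qed
  have Skj: "S k j = 0" if "S j j = 0" "k \<in> I" for k
  proof -
    have "(\<Sum>i\<in>I. (if i = k then 1 else 0) * S i j) = (\<Sum>i\<in>I. if i = k then S i j else 0)"
      by (intro sum.cong) auto
    then show ?thesis
      using linear_zero[of "\<lambda>i. if i = k then 1 else 0"] that insert.hyps by simp
  qed
  text \<open>
    One Cholesky step: eliminate \<open>j\<close> by the Schur complement. If \<open>S j j = 0\<close>, the junk value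
    \<open>x / 0 = 0\<close> gives \<open>S' = S\<close>, which is what is needed, since then \<open>S k j = 0\<close>.
  \<close>
  define S' where "S' k l = S k l - S k j * S l j / S j j" for k l
  have "\<exists>B :: 'k \<Rightarrow> 'k \<Rightarrow> real. \<forall>k\<in>I. \<forall>l\<in>I. (\<Sum>m\<in>I. B k m * B l m) = S' k l"
  proof (rule insert.IH)
    show "S' k l = S' l k" for k l
      using insert.prems(1)[of k l] by (simp add: S'_def)
    fix x :: "'k \<Rightarrow> real"
    let ?d = "\<Sum>k\<in>I. x k * S k j"
    have "(\<Sum>k\<in>I. \<Sum>l\<in>I. x k * x l * S' k l)
        = (\<Sum>k\<in>I. \<Sum>l\<in>I. x k * x l * S k l) - ?d * ?d / S j j"
      by (simp add: S'_def right_diff_distrib sum_subtractf sum_product sum_divide_distrib algebra_simps)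
    \<comment> \<open>For \<open>S j j > 0\<close> the point \<open>- ?d / S j j\<close> minimizes
      the quadratic polynomial, and the minimum is the form of \<open>S'\<close>. For
      \<open>S j j = 0\<close> both sides here are 0.\<close>
    moreover have "(- ?d / S j j)\<^sup>2 * S j j + 2 * (- ?d / S j j) * ?d = - (?d * ?d / S j j)"
      by (cases "S j j = 0") (simp_all add: power2_eq_square)
    ultimately show "0 \<le> (\<Sum>k\<in>I. \<Sum>l\<in>I. x k * x l * S' k l)"
      using nonneg[of "- ?d / S j j" x] by linarith
  qed
  then obtain B :: "'k \<Rightarrow> 'k \<Rightarrow> real"
    where B: "\<And>k l. k \<in> I \<Longrightarrow> l \<in> I \<Longrightarrow> (\<Sum>m\<in>I. B k m * B l m) = S' k l" by blast
  \<comment> \<open>Column \<open>j\<close> of the factor carries the rank-one part removed from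
    \<open>S\<close>, and the columns in \<open>I\<close> carry the factor of \<open>S'\<close>. Row
    \<open>j\<close> is zero off its diagonal entry.\<close>
  define C where "C k m = (if m = j then S k j / sqrt (S j j) else if k = j then 0 else B k m)" for k m
  have rest: "(\<Sum>m\<in>I. C k m * C l m) = (if k = j \<or> l = j then 0 else \<Sum>m\<in>I. B k m * B l m)" for k l
    using insert.hyps by (auto simp: C_def intro!: sum.cong sum.neutral)
  have root: "a / sqrt (S j j) * (b / sqrt (S j j)) = a * b / S j j" for a b
    using Sjj by simp
  have "(\<Sum>m\<in>insert j I. C k m * C l m) = S k l" if "k \<in> insert j I" "l \<in> insert j I" for k l
  proof -
    have "(\<Sum>m\<in>insert j I. C k m * C l m)
        = S k j * S l j / S j j + (if k = j \<or> l = j then 0 else \<Sum>m\<in>I. B k m * B l m)"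
      using insert.hyps by (simp add: rest) (simp add: C_def root Sjj)
    also have "\<dots> = S k l"
      using that B[of k l] Skj[of k] Skj[of l] insert.prems(1)[of j k] insert.prems(1)[of j l] insert.hyps
      by (cases "S j j = 0") (auto simp: S'_def)
    finally show ?thesis .
  qed
  then show ?case by blast
qed

lemma psd_matrix_factorization:
  fixes S :: "real ^ 'k ^ 'k"
  assumes "\<And>k l. S $ k $ l = S $ l $ k"
    and "\<And>x. 0 \<le> (\<Sum>k\<in>UNIV. \<Sum>l\<in>UNIV. x k * x l * S $ k $ l)"
  obtains A :: "real ^ 'k ^ 'k" where "A ** transpose A = S"
proof -
  obtain B :: "'k \<Rightarrow> 'k \<Rightarrow> real" where B: "\<And>k l. (\<Sum>m\<in>UNIV. B k m * B l m) = S $ k $ l"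
    using psd_gram_representation[of UNIV "\<lambda>k l. S $ k $ l"] assms by auto
  have "(\<chi> k m. B k m) ** transpose (\<chi> k m. B k m) = S"
    by (simp add: vec_eq_iff matrix_matrix_mult_def transpose_def B)
  then show thesis by (rule that)
qed

subsection \<open>Trigonometric polynomials\<close>

text \<open>The phase \<open>b\<close> lets cosines also express sines and constants, so that the
  class is a real algebra without complex exponentials. Expectations of its members are determined
  by those of single waves.\<close>

inductive trig_polynomial :: "('a::real_inner \<Rightarrow> real) \<Rightarrow> bool" where
  wave: "trig_polynomial (\<lambda>x. a * cos (t \<bullet> x + b))"
| add: "trig_polynomial f \<Longrightarrow> trig_polynomial g \<Longrightarrow> trig_polynomial (\<lambda>x. f x + g x)"

lemma trig_polynomial_const: "trig_polynomial (\<lambda>x. c)"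
  using trig_polynomial.wave[of c 0 0] by simp

lemma trig_polynomial_sin: "trig_polynomial (\<lambda>x. sin (t \<bullet> x))"
  using trig_polynomial.wave[of 1 t "- pi / 2"] by (simp add: cos_diff)

lemma trig_polynomial_scale: "trig_polynomial f \<Longrightarrow> trig_polynomial (\<lambda>x. c * f x)"
proof (induction rule: trig_polynomial.induct)
  case (wave a t b)
  then show ?case using trig_polynomial.wave[of "c * a" t b] by (simp add: mult.assoc)
qed (simp add: distrib_left trig_polynomial.add)

lemma trig_polynomial_sum:
  "(\<And>i. i \<in> I \<Longrightarrow> trig_polynomial (f i)) \<Longrightarrow> trig_polynomial (\<lambda>x. \<Sum>i\<in>I. f i x)"
  by (induction I rule: infinite_finite_induct)
     (simp_all add: trig_polynomial_const trig_polynomial.add)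

text \<open>Product-to-sum formula for two waves; the nested induction extends it by
  bilinearity.\<close>

lemma trig_polynomial_mult:
  assumes "trig_polynomial f" "trig_polynomial g"
  shows "trig_polynomial (\<lambda>x. f x * g x)"
  using assms(1)
proof (induction rule: trig_polynomial.induct)
  case (wave a t b)
  from assms(2) show ?case
  proof (induction rule: trig_polynomial.induct)
    case (wave a' t' b')
    have "a * cos (t \<bullet> x + b) * (a' * cos (t' \<bullet> x + b'))
        = a * a' / 2 * cos ((t - t') \<bullet> x + (b - b')) + a * a' / 2 * cos ((t + t') \<bullet> x + (b + b'))" for x
    proof -
      have "cos (t \<bullet> x + b) * cos (t' \<bullet> x + b')
        = (cos ((t \<bullet> x + b) - (t' \<bullet> x + b')) + cos ((t \<bullet> x + b) + (t' \<bullet> x + b'))) / 2"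
        by (rule cos_times_cos)
      moreover have "(t \<bullet> x + b) - (t' \<bullet> x + b') = (t - t') \<bullet> x + (b - b')"
        "(t \<bullet> x + b) + (t' \<bullet> x + b') = (t + t') \<bullet> x + (b + b')"
        by (simp_all add: inner_diff_left inner_add_left)
      ultimately show ?thesis by (simp add: field_simps)
    qed
    then show ?case
      by (simp only: trig_polynomial.intros)
  next
    case (add f' g')
    then show ?case by (simp add: distrib_left trig_polynomial.add)
  qed
next
  case (add f' g')
  then show ?case by (simp add: distrib_right trig_polynomial.add)
qed

text \<open>Closure under sums and products leaves the case of a linear functional. It is expanded
  in the standard basis, where \<open>sin (x $ i / L)\<close> is a wave with frequency vector
  \<open>axis i (1 / L)\<close>.\<close>

lemma polynomial_in_sines_trig_polynomial:
  fixes p :: "real ^ 'k \<Rightarrow> real"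
  assumes "real_polynomial_function p"
  shows "trig_polynomial (\<lambda>x. p (\<chi> i. sin (x $ i / L)))"
  using assms
proof (induction rule: real_polynomial_function.induct)
  case (linear f)
  interpret bounded_linear f by fact
  have "f (\<chi> i. sin (x $ i / L)) = (\<Sum>i\<in>UNIV. f (axis i 1) * sin (axis i (1 / L) \<bullet> x))" for x
  proof -
    have "f (\<chi> i. sin (x $ i / L)) = f (\<Sum>i\<in>UNIV. sin (x $ i / L) *\<^sub>R axis i 1)"
      using basis_expansion[of "\<chi> i. sin (x $ i / L)"] by (simp add: scalar_mult_eq_scaleR)
    also have "\<dots> = (\<Sum>i\<in>UNIV. sin (x $ i / L) * f (axis i 1))"
      by (simp only: sum scaleR real_scaleR_def)
    finally show ?thesis by (simp add: inner_axis inner_axis' mult.commute)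
  qed
  then show ?case
    by (simp only: trig_polynomial_sum trig_polynomial_scale trig_polynomial_sin)
next
  case (const c)
  then show ?case by (rule trig_polynomial_const)
next
  case (add f g)
  then show ?case by (intro trig_polynomial.add)
next
  case (mult f g)
  then show ?case by (intro trig_polynomial_mult)
qed

text \<open>The error may grow linearly in \<open>x\<close>: after integration it becomes a multiple
  of first absolute moments over \<open>L\<close>, which is small for large \<open>L\<close> when
  the moments are bounded.\<close>

lemma trig_polynomial_approximation:
  fixes f :: "real ^ 'k \<Rightarrow> real"
  assumes cont: "continuous_on UNIV f" and bound: "\<And>x. \<bar>f x\<bar> \<le> B" and L: "L > 0" and e: "e > 0"
  obtains g where "trig_polynomial g"
    and "\<And>x. \<bar>f x - g x\<bar> \<le> e + 2 * B * (\<Sum>k\<in>UNIV. \<bar>x $ k\<bar>) / L"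
proof -
  let ?S = "cbox (-1) 1 :: (real ^ 'k) set"
  text \<open>
    On the cube of side \<open>2 L\<close>, clipping the coordinates by \<open>L * arcsin (sin (x / L))\<close> changes nothing;
    everywhere, it makes \<open>f\<close> a continuous function of the sines, to which the Weierstrass theorem
    applies on a compact set. Hence the approximation is uniform on the whole space.
  \<close>
  define h where "h y = f (\<chi> i. L * arcsin (y $ i))" for y :: "real ^ 'k"
  have "continuous_on ?S h"
    unfolding h_def
  proof (rule continuous_on_compose2[OF cont])
    show "continuous_on ?S (\<lambda>y. \<chi> i. L * arcsin (y $ i))"
      by (intro continuous_on_vec_lambda continuous_on_mult continuous_on_const
            continuous_on_arcsin continuous_on_component continuous_on_id)
         (simp add: mem_box_cart)
  qed simp
  then obtain p where p: "real_polynomial_function p" "\<And>y. y \<in> ?S \<Longrightarrow> \<bar>h y - p y\<bar> < e"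
    using Stone_Weierstrass_real_polynomial_function[of ?S h e] e by auto
  have B: "0 \<le> B" using bound[of 0] by simp
  have "\<bar>f x - p (\<chi> i. sin (x $ i / L))\<bar> \<le> e + 2 * B * (\<Sum>k\<in>UNIV. \<bar>x $ k\<bar>) / L" for x
  proof -
    let ?y = "\<chi> i. sin (x $ i / L)"
    have "?y \<in> ?S" by (simp add: mem_box_cart)
    then have "\<bar>h ?y - p ?y\<bar> \<le> e" using p(2)[of ?y] by simp
    moreover have "\<bar>f x - h ?y\<bar> \<le> 2 * B * (\<Sum>k\<in>UNIV. \<bar>x $ k\<bar>) / L"
    proof (cases "\<forall>k. \<bar>x $ k\<bar> \<le> L")
      case True
      have "L * arcsin (sin (x $ k / L)) = x $ k" for k
      proof -
        \<comment> \<open>Since \<open>1 < pi / 2\<close>, the argument lies on the branch of the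
          sine that \<open>arcsin\<close> inverts.\<close>
        have "\<bar>x $ k / L\<bar> \<le> 1" using True L by (simp add: abs_divide)
        then have "arcsin (sin (x $ k / L)) = x $ k / L"
          using pi_gt3 by (intro arcsin_sin) linarith+
        then show ?thesis using L by simp
      qed
      then have "h ?y = f x" by (simp add: h_def vec_nth_inverse)
      then show ?thesis using B L by (simp add: sum_nonneg)
    next
      case False
      \<comment> \<open>Outside the cube the moment term is at least \<open>2 * B\<close>, which
        bounds the distance of any two values of \<open>f\<close>.\<close>
      then obtain k where "L < \<bar>x $ k\<bar>" by (auto simp: not_le)
      also have "\<dots> \<le> (\<Sum>k\<in>UNIV. \<bar>x $ k\<bar>)" by (rule member_le_sum) auto
      finally have "1 \<le> (\<Sum>k\<in>UNIV. \<bar>x $ k\<bar>) / L" using L by simp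
      then have "2 * B * 1 \<le> 2 * B * ((\<Sum>k\<in>UNIV. \<bar>x $ k\<bar>) / L)"
        using B by (intro mult_left_mono) auto
      moreover have "\<bar>f x - h ?y\<bar> \<le> 2 * B"
        using bound[of x] bound[of "\<chi> i. L * arcsin (?y $ i)"] unfolding h_def by linarith
      ultimately show ?thesis by simp
    qed
    ultimately show ?thesis by linarith
  qed
  with polynomial_in_sines_trig_polynomial[OF p(1)] show thesis by (rule that)
qed

section \<open>Measurability and expectations of trigonometric polynomials\<close>

lemma borel_measurable_vec_nth [measurable]: "(\<lambda>x :: real ^ 'k. x $ k) \<in> borel_measurable borel"
  by (intro borel_measurable_continuous_onI continuous_intros)

lemma borel_measurable_vec_lambda:
  fixes f :: "'k::finite \<Rightarrow> 'a \<Rightarrow> real"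
  assumes "\<And>k. f k \<in> borel_measurable M"
  shows "(\<lambda>x. \<chi> k. f k x) \<in> borel_measurable M"
proof (rule iffD2[OF borel_measurable_euclidean_space], rule ballI)
  fix v :: "real ^ 'k" assume "v \<in> Basis"
  then obtain k where "v = axis k 1" by (auto simp: Basis_vec_def)
  then show "(\<lambda>x. (\<chi> k. f k x) \<bullet> v) \<in> borel_measurable M"
    using assms[of k] by (simp add: inner_axis)
qed

lemma trig_polynomial_borel_measurable:
  fixes f :: "'a::{real_inner, second_countable_topology} \<Rightarrow> real"
  shows "trig_polynomial f \<Longrightarrow> f \<in> borel_measurable borel"
  by (induction rule: trig_polynomial.induct) simp_all

lemma trig_polynomial_bounded: "trig_polynomial f \<Longrightarrow> \<exists>B. \<forall>x. \<bar>f x\<bar> \<le> B"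
proof (induction rule: trig_polynomial.induct)
  case (wave a t b)
  have "\<bar>a * cos (t \<bullet> x + b)\<bar> \<le> \<bar>a\<bar>" for x
    using mult_left_mono[OF abs_cos_le_one[of "t \<bullet> x + b"], of "\<bar>a\<bar>"] by (simp add: abs_mult)
  then show ?case by blast
next
  case (add f g)
  then show ?case by (meson abs_triangle_ineq add_mono order_trans)
qed

lemma (in prob_space) integrable_trig_polynomial:
  fixes f :: "'b::{real_inner, second_countable_topology} \<Rightarrow> real"
  assumes "trig_polynomial f" "Z \<in> borel_measurable M"
  shows "integrable M (\<lambda>\<omega>. f (Z \<omega>))"
proof -
  obtain B where "\<And>x. \<bar>f x\<bar> \<le> B" using trig_polynomial_bounded[OF assms(1)] by blast
  then show ?thesis
    using measurable_compose[OF assms(2) trig_polynomial_borel_measurable[OF assms(1)]]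
    by (intro integrable_const_bound[where B = B]) auto
qed

lemma trig_polynomial_expectation_tendsto:
  fixes f :: "'b::{real_inner, second_countable_topology} \<Rightarrow> real"
  assumes "prob_space M" "prob_space N" "sets N = sets borel"
    and Z: "\<And>n. Z n \<in> borel_measurable M"
    and conv: "\<And>t b. (\<lambda>n. \<integral>\<omega>. cos (t \<bullet> Z n \<omega> + b) \<partial>M) \<longlonglongrightarrow> (\<integral>x. cos (t \<bullet> x + b) \<partial>N)"
    and "trig_polynomial f"
  shows "(\<lambda>n. \<integral>\<omega>. f (Z n \<omega>) \<partial>M) \<longlonglongrightarrow> (\<integral>x. f x \<partial>N)"
  using assms(6)
proof (induction rule: trig_polynomial.induct)
  case (wave a t b)
  show ?case using tendsto_mult[OF tendsto_const conv[of t b], of a] by simp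
next
  case (add f g)
  have "(\<lambda>x. x) \<in> borel_measurable N" using assms(3) by (simp add: measurable_def space_borel sets_eq_imp_space_eq)
  then show ?case
    using tendsto_add[OF add.IH] prob_space.integrable_trig_polynomial[OF assms(1) _ Z]
      prob_space.integrable_trig_polynomial[OF assms(2), of _ "\<lambda>x. x"] add.hyps
    by simp
qed

text \<open>Integrates the pointwise error. It is stated for any random vector, so that it serves
  both for \<open>Z n\<close> under \<open>M\<close> and for the identity under
  \<open>N\<close>.\<close>

lemma (in prob_space) expectation_trig_approximation_error:
  fixes f g :: "real ^ 'k \<Rightarrow> real"
  assumes Z: "Z \<in> borel_measurable M" and f: "continuous_on UNIV f" "\<And>x. \<bar>f x\<bar> \<le> B"
    and g: "trig_polynomial g" "\<And>x. \<bar>f x - g x\<bar> \<le> e + 2 * B * (\<Sum>k\<in>UNIV. \<bar>x $ k\<bar>) / L"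
    and "L > 0" and int: "\<And>k. integrable M (\<lambda>\<omega>. Z \<omega> $ k)"
    and C: "\<And>k. (\<integral>\<omega>. \<bar>Z \<omega> $ k\<bar> \<partial>M) \<le> C"
  shows "\<bar>(\<integral>\<omega>. f (Z \<omega>) \<partial>M) - (\<integral>\<omega>. g (Z \<omega>) \<partial>M)\<bar> \<le> e + 2 * B * (real CARD('k) * C) / L"
proof -
  have B: "0 \<le> B" using f(2)[of 0] by simp
  have intf: "integrable M (\<lambda>\<omega>. f (Z \<omega>))"
    using measurable_compose[OF Z borel_measurable_continuous_onI[OF f(1)]] f(2)
    by (intro integrable_const_bound[where B = B]) auto
  have intg: "integrable M (\<lambda>\<omega>. g (Z \<omega>))" by (rule integrable_trig_polynomial[OF g(1) Z])
  have "\<bar>(\<integral>\<omega>. f (Z \<omega>) \<partial>M) - (\<integral>\<omega>. g (Z \<omega>) \<partial>M)\<bar> = \<bar>\<integral>\<omega>. f (Z \<omega>) - g (Z \<omega>) \<partial>M\<bar>"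
    using intf intg by simp
  also have "\<dots> \<le> (\<integral>\<omega>. \<bar>f (Z \<omega>) - g (Z \<omega>)\<bar> \<partial>M)"
    by (rule integral_abs_bound)
  also have "\<dots> \<le> (\<integral>\<omega>. e + 2 * B * (\<Sum>k\<in>UNIV. \<bar>Z \<omega> $ k\<bar>) / L \<partial>M)"
    using intf intg int g(2) by (intro integral_mono) auto
  also have "\<dots> = e + 2 * B * (\<Sum>k\<in>UNIV. \<integral>\<omega>. \<bar>Z \<omega> $ k\<bar> \<partial>M) / L"
    using int by (simp add: prob_space)
  also have "\<dots> \<le> e + 2 * B * (real CARD('k) * C) / L"
    using sum_mono[of UNIV "\<lambda>k. \<integral>\<omega>. \<bar>Z \<omega> $ k\<bar> \<partial>M" "\<lambda>_. C"] C B \<open>L > 0\<close>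
    by (intro add_left_mono divide_right_mono mult_left_mono) auto
  finally show ?thesis .
qed

subsection \<open>Convergence in distribution in Euclidean space\<close>

text \<open>A form of Levy's continuity theorem in which an eventual bound on first absolute moments
  guards against loss of mass at infinity. The proof compares \<open>f\<close> with one
  trigonometric polynomial under both laws.\<close>

theorem converges_in_distribution_if_trig_converges:
  fixes Z :: "nat \<Rightarrow> 'a \<Rightarrow> real ^ 'k"
  assumes M: "prob_space M" and N: "prob_space N" "sets N = sets borel"
    and Z: "\<And>n. Z n \<in> borel_measurable M"
    and Z_int: "\<And>n k. integrable M (\<lambda>\<omega>. Z n \<omega> $ k)"
    and Z_bound: "\<And>k. \<forall>\<^sub>F n in sequentially. (\<integral>\<omega>. \<bar>Z n \<omega> $ k\<bar> \<partial>M) \<le> C"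
    and N_int: "\<And>k. integrable N (\<lambda>x. x $ k)"
    and conv: "\<And>t b. (\<lambda>n. \<integral>\<omega>. cos (t \<bullet> Z n \<omega> + b) \<partial>M) \<longlonglongrightarrow> (\<integral>x. cos (t \<bullet> x + b) \<partial>N)"
  shows "converges_in_distribution M Z N"
  unfolding converges_in_distribution_def
proof (intro allI impI)
  fix f :: "real ^ 'k \<Rightarrow> real"
  assume f: "continuous_on UNIV f \<and> bounded (range f)"
  then obtain B where B: "\<And>x. \<bar>f x\<bar> \<le> B" by (auto simp: bounded_iff)
  have id: "(\<lambda>x. x) \<in> borel_measurable N"
    using N(2) by (simp add: measurable_def space_borel sets_eq_imp_space_eq)
  \<comment> \<open>One constant for all coordinates, valid under \<open>N\<close> and eventually
    under \<open>M\<close>.\<close>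
  define D where "D = max C (\<Sum>k\<in>UNIV. \<integral>x. \<bar>x $ k\<bar> \<partial>N)"
  have D_N: "(\<integral>x. \<bar>x $ k\<bar> \<partial>N) \<le> D" for k
  proof -
    have "(\<integral>x. \<bar>x $ k\<bar> \<partial>N) \<le> (\<Sum>k\<in>UNIV. \<integral>x. \<bar>x $ k\<bar> \<partial>N)"
      by (rule member_le_sum) auto
    then show ?thesis by (simp add: D_def)
  qed
  have "(\<lambda>n. \<integral>\<omega>. f (Z n \<omega>) \<partial>M) \<longlonglongrightarrow> (\<integral>x. f x \<partial>N)"
  proof (rule LIMSEQ_I)
    fix r :: real assume r: "r > 0"
    \<comment> \<open>\<open>K\<close> dominates \<open>2 * B * (real CARD('k) * D)\<close>, and the
      added ones keep it positive, so that \<open>L > 0\<close>. This \<open>L\<close> makes each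
      moment error at most \<open>r / 4\<close>; the total is at most
      \<open>2 * (r / 12 + r / 4) + r / 4 < r\<close>.\<close>
    define K where "K = 2 * (\<bar>B\<bar> + 1) * (real CARD('k) * (\<bar>D\<bar> + 1))"
    define L where "L = 4 * K / r"
    have K: "K > 0" unfolding K_def by (intro mult_pos_pos) auto
    then have L: "L > 0" using r by (simp add: L_def)
    obtain g where g: "trig_polynomial g"
      "\<And>x. \<bar>f x - g x\<bar> \<le> r / 12 + 2 * B * (\<Sum>k\<in>UNIV. \<bar>x $ k\<bar>) / L"
      using trig_polynomial_approximation[of f B L "r / 12"] f B L r by auto
    have "2 * B * (real CARD('k) * D) \<le> \<bar>2 * B * (real CARD('k) * D)\<bar>" by (rule abs_ge_self)
    also have "\<dots> = 2 * \<bar>B\<bar> * (real CARD('k) * \<bar>D\<bar>)" by (simp add: abs_mult)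
    also have "\<dots> \<le> K"
      unfolding K_def by (intro mult_mono) auto
    finally have "2 * B * (real CARD('k) * D) / L \<le> K / L"
      using L by (intro divide_right_mono) auto
    then have err: "2 * B * (real CARD('k) * D) / L \<le> r / 4"
      using K r by (simp add: L_def)
    have "\<forall>\<^sub>F n in sequentially. \<forall>k. (\<integral>\<omega>. \<bar>Z n \<omega> $ k\<bar> \<partial>M) \<le> D"
    proof (rule eventually_all_finite)
      show "\<forall>\<^sub>F n in sequentially. (\<integral>\<omega>. \<bar>Z n \<omega> $ k\<bar> \<partial>M) \<le> D" for k
        using Z_bound[of k] by eventually_elim (simp add: D_def)
    qed
    moreover have "\<forall>\<^sub>F n in sequentially. dist (\<integral>\<omega>. g (Z n \<omega>) \<partial>M) (\<integral>x. g x \<partial>N) < r / 4"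
      using trig_polynomial_expectation_tendsto[OF M N Z conv g(1)] r by (intro tendstoD) auto
    ultimately have "\<forall>\<^sub>F n in sequentially. norm ((\<integral>\<omega>. f (Z n \<omega>) \<partial>M) - (\<integral>x. f x \<partial>N)) < r"
    proof eventually_elim
      case (elim n)
      have "\<bar>(\<integral>\<omega>. f (Z n \<omega>) \<partial>M) - (\<integral>\<omega>. g (Z n \<omega>) \<partial>M)\<bar> \<le> r / 12 + 2 * B * (real CARD('k) * D) / L"
        using prob_space.expectation_trig_approximation_error[OF M Z _ B g L Z_int] f elim(1) by blast
      moreover have "\<bar>(\<integral>x. f x \<partial>N) - (\<integral>x. g x \<partial>N)\<bar> \<le> r / 12 + 2 * B * (real CARD('k) * D) / L"
        using prob_space.expectation_trig_approximation_error[OF N(1) id _ B g L N_int] f D_N by blast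
      ultimately show ?case
        using elim(2) err r unfolding dist_real_def real_norm_def by linarith
    qed
    then show "\<exists>no. \<forall>n\<ge>no. norm ((\<integral>\<omega>. f (Z n \<omega>) \<partial>M) - (\<integral>x. f x \<partial>N)) < r"
      by (simp add: eventually_sequentially)
  qed
  then show "(\<lambda>n. \<integral>x. f x \<partial>distr M borel (Z n)) \<longlonglongrightarrow> (\<integral>x. f x \<partial>N)"
    using Z f by (simp add: integral_distr borel_measurable_continuous_onI)
qed

subsection \<open>Normal distributions\<close>

lemma integrable_std_normal_cis: "integrable std_normal_distribution (\<lambda>y. cis (a * y))"
proof -
  interpret real_distribution std_normal_distribution by (rule real_dist_normal_dist)
  show ?thesis
    unfolding cis_conv_exp by (rule integrable_iexp) auto
qed

text \<open>Up to the constant factor \<open>cis b\<close>, the cosine is the real part of a product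
  of factors \<open>cis (a i * z i)\<close>, whose integral under a product measure is the product
  of one-dimensional characteristic functions.\<close>

lemma integral_PiM_std_normal_cos:
  fixes a :: "'k::finite \<Rightarrow> real"
  shows "(\<integral>z. cos ((\<Sum>i\<in>UNIV. a i * z i) + b) \<partial>(\<Pi>\<^sub>M i\<in>UNIV. std_normal_distribution))
    = cos b * exp (- (\<Sum>i\<in>UNIV. (a i)\<^sup>2) / 2)"
proof -
  interpret real_distribution std_normal_distribution by (rule real_dist_normal_dist)
  let ?P = "\<Pi>\<^sub>M i\<in>(UNIV :: 'k set). std_normal_distribution"
  interpret product_prob_space "\<lambda>_. std_normal_distribution" "UNIV :: 'k set" ..
  have prod_cis: "(\<Prod>i\<in>I. cis (f i)) = cis (sum f I)" for I :: "'k set" and f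
    by (induction I rule: infinite_finite_induct) (simp_all add: cis_mult)
  have int: "integrable ?P (\<lambda>z. \<Prod>i\<in>UNIV. cis (a i * z i))"
    by (rule product_integrable_prod) (simp_all add: integrable_std_normal_cis)
  have "(\<integral>z. cos ((\<Sum>i\<in>UNIV. a i * z i) + b) \<partial>?P) = (\<integral>z. Re (cis b * (\<Prod>i\<in>UNIV. cis (a i * z i))) \<partial>?P)"
    by (intro Bochner_Integration.integral_cong refl)
       (simp add: prod_cis cis_mult add.commute)
  also have "\<dots> = Re (\<integral>z. cis b * (\<Prod>i\<in>UNIV. cis (a i * z i)) \<partial>?P)"
    using int by (intro integral_Re) simp
  also have "(\<integral>z. cis b * (\<Prod>i\<in>UNIV. cis (a i * z i)) \<partial>?P)
      = cis b * (\<Prod>i\<in>UNIV. char std_normal_distribution (a i))"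
    using int
    by (simp add: product_integral_prod[where f = "\<lambda>i y. cis (a i * y)"] integrable_std_normal_cis
        char_def cis_conv_exp[symmetric] del: of_real_mult)
  also have "(\<Prod>i\<in>UNIV. char std_normal_distribution (a i)) = complex_of_real (exp (- (\<Sum>i\<in>UNIV. (a i)\<^sup>2) / 2))"
    by (simp add: char_std_normal_distribution exp_sum sum_divide_distrib flip: sum_negf)
  finally show ?thesis by simp
qed

text \<open>The features of the normal law on which the limit theorem relies. In the cosine formula
  the exponent is minus half the squared norm of \<open>transpose A *v t\<close>, which equals
  \<open>t \<bullet> (S *v t)\<close> whichever factor \<open>A\<close> was chosen.\<close>

lemma multivariate_normal_properties:
  fixes S :: "real ^ 'k ^ 'k"
  assumes "is_multivariate_normal 0 S N"
  shows "prob_space N" and "sets N = sets borel"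
    and "integrable N (\<lambda>x. x $ k)"
    and "(\<integral>x. cos (t \<bullet> x + b) \<partial>N) = cos b * exp (- (t \<bullet> (S *v t)) / 2)"
proof -
  let ?P = "\<Pi>\<^sub>M i\<in>(UNIV :: 'k set). std_normal_distribution"
  obtain A where A: "A ** transpose A = S"
    and N: "N = distr ?P borel (\<lambda>z. A *v (\<chi> i. z i))"
    using assms by (auto simp: is_multivariate_normal_def)
  interpret real_distribution std_normal_distribution by (rule real_dist_normal_dist)
  interpret P: product_prob_space "\<lambda>_. std_normal_distribution" "UNIV :: 'k set" ..
  have lam: "(\<lambda>z. A *v (\<chi> i. z i)) \<in> borel_measurable ?P"
    unfolding matrix_vector_mult_def by (intro borel_measurable_vec_lambda) simp
  show "prob_space N" unfolding N by (rule P.prob_space_distr[OF lam])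
  show "sets N = sets borel" by (simp add: N)
  have comp: "integrable ?P (\<lambda>z. z i)" for i
  proof -
    have "integrable (distr ?P std_normal_distribution (\<lambda>z. z i)) (\<lambda>y. y)"
      using integrable_std_normal_distribution_moment[of 1] by (simp add: P.PiM_component)
    then show ?thesis by (rule integrable_distr[rotated]) simp
  qed
  show "integrable N (\<lambda>x. x $ k)"
    unfolding N using comp
    by (subst integrable_distr_eq[OF lam]) (simp_all add: matrix_vector_mult_def)
  have lin: "t \<bullet> (A *v (\<chi> i. z i)) = (\<Sum>i\<in>UNIV. (transpose A *v t) $ i * z i)" for z
  proof -
    have "t \<bullet> (A *v (\<chi> i. z i)) = (t v* A) \<bullet> (\<chi> i. z i)"
      by (rule dot_lmul_matrix[symmetric])
    then show ?thesis by (simp add: inner_vec_def)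
  qed
  have "(\<integral>x. cos (t \<bullet> x + b) \<partial>N) = (\<integral>z. cos ((\<Sum>i\<in>UNIV. (transpose A *v t) $ i * z i) + b) \<partial>?P)"
    unfolding N by (subst integral_distr[OF lam]) (simp_all add: lin)
  also have "\<dots> = cos b * exp (- (\<Sum>i\<in>UNIV. ((transpose A *v t) $ i)\<^sup>2) / 2)"
    by (rule integral_PiM_std_normal_cos)
  also have "(\<Sum>i\<in>UNIV. ((transpose A *v t) $ i)\<^sup>2) = (transpose A *v t) \<bullet> (transpose A *v t)"
    by (simp add: inner_vec_def power2_eq_square)
  also have "\<dots> = t \<bullet> (S *v t)"
    unfolding A[symmetric] matrix_vector_mul_assoc[symmetric]
    by (simp add: dot_lmul_matrix[symmetric])
  finally show "(\<integral>x. cos (t \<bullet> x + b) \<partial>N) = cos b * exp (- (t \<bullet> (S *v t)) / 2)" .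
qed

subsection \<open>The multivariate central limit theorem\<close>

lemma abs_mult_le_sum_squares: "\<bar>a * c\<bar> \<le> a\<^sup>2 + (c :: real)\<^sup>2"
  using sum_squares_bound[of "\<bar>a\<bar>" "\<bar>c\<bar>"] mult_nonneg_nonneg[of "\<bar>a\<bar>" "\<bar>c\<bar>"]
  unfolding abs_mult power2_abs by linarith

lemma integrable_mult_if_square_integrable:
  fixes U V :: "'a \<Rightarrow> real"
  assumes "U \<in> borel_measurable M" "V \<in> borel_measurable M"
    and "integrable M (\<lambda>\<omega>. (U \<omega>)\<^sup>2)" "integrable M (\<lambda>\<omega>. (V \<omega>)\<^sup>2)"
  shows "integrable M (\<lambda>\<omega>. U \<omega> * V \<omega>)"
proof (rule Bochner_Integration.integrable_bound)
  show "integrable M (\<lambda>\<omega>. (U \<omega>)\<^sup>2 + (V \<omega>)\<^sup>2)" using assms by simp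
qed (use assms abs_mult_le_sum_squares in auto)

text \<open>Cross terms vanish by independence and zero means. Integrability and the value are
  proved together, as the induction step needs both for the smaller sum.\<close>

lemma (in prob_space) second_moment_sum:
  fixes X :: "'i \<Rightarrow> 'a \<Rightarrow> real"
  assumes "finite I" "indep_vars (\<lambda>_. borel) X I"
    and sq: "\<And>i. i \<in> I \<Longrightarrow> integrable M (\<lambda>\<omega>. (X i \<omega>)\<^sup>2)"
    and mean: "\<And>i. i \<in> I \<Longrightarrow> expectation (X i) = 0"
  shows "integrable M (\<lambda>\<omega>. (\<Sum>i\<in>I. X i \<omega>)\<^sup>2) \<and>
    expectation (\<lambda>\<omega>. (\<Sum>i\<in>I. X i \<omega>)\<^sup>2) = (\<Sum>i\<in>I. expectation (\<lambda>\<omega>. (X i \<omega>)\<^sup>2))"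
  using assms
proof (induction I rule: finite_induct)
  case empty
  then show ?case by simp
next
  case (insert j I)
  let ?S = "\<lambda>\<omega>. \<Sum>i\<in>I. X i \<omega>"
  have IH: "integrable M (\<lambda>\<omega>. (?S \<omega>)\<^sup>2)"
    "expectation (\<lambda>\<omega>. (?S \<omega>)\<^sup>2) = (\<Sum>i\<in>I. expectation (\<lambda>\<omega>. (X i \<omega>)\<^sup>2))"
    using insert.IH indep_vars_subset[OF insert.prems(1), of I] insert.prems by auto
  have meas: "X i \<in> borel_measurable M" if "i \<in> insert j I" for i
    using insert.prems(1) that by (auto simp: indep_vars_def2)
  have ind: "indep_var borel (X j) borel ?S"
    by (rule indep_vars_sum) (use insert in auto)
  have intj: "integrable M (X j)"
    by (rule square_integrable_imp_integrable) (use meas insert.prems in auto)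
  have intS: "integrable M ?S"
    by (rule square_integrable_imp_integrable) (use meas IH in auto)
  have cross: "integrable M (\<lambda>\<omega>. X j \<omega> * ?S \<omega>)" "expectation (\<lambda>\<omega>. X j \<omega> * ?S \<omega>) = 0"
    using indep_var_integrable[OF ind intj intS] indep_var_lebesgue_integral[OF ind intj intS]
      insert.prems(3)[of j] by simp_all
  have "(\<Sum>i\<in>insert j I. X i \<omega>)\<^sup>2 = (X j \<omega>)\<^sup>2 + (?S \<omega>)\<^sup>2 + 2 * (X j \<omega> * ?S \<omega>)" for \<omega>
    using insert.hyps by (simp add: power2_sum algebra_simps)
  then show ?case
    using IH cross insert.prems(2)[of j] insert.hyps by simp
qed

section \<open>The one-dimensional limit of cosine expectations\<close>

lemma integral_std_normal_cos:
  "(\<integral>y. cos (a * y + b) \<partial>std_normal_distribution) = cos b * exp (- a\<^sup>2 / 2)"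
proof -
  have "(\<integral>y. cos (a * y + b) \<partial>std_normal_distribution)
      = (\<integral>y. Re (cis b * cis (a * y)) \<partial>std_normal_distribution)"
    by (intro Bochner_Integration.integral_cong refl) (simp only: cis_mult cis.sel add.commute)
  also have "\<dots> = Re (\<integral>y. cis b * cis (a * y) \<partial>std_normal_distribution)"
    by (intro integral_Re integrable_mult_right integrable_std_normal_cis)
  also have "(\<integral>y. cis b * cis (a * y) \<partial>std_normal_distribution) = cis b * char std_normal_distribution a"
    by (simp add: char_def cis_conv_exp[symmetric] del: of_real_mult)
  finally show ?thesis by (simp add: char_std_normal_distribution)
qed

text \<open>The central limit theorem is applied for \<open>s > 0\<close>. The case
  \<open>s = 0\<close>, where all \<open>X n\<close> vanish almost surely, is included because a
  singular covariance matrix has directions without variance.\<close>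

lemma (in prob_space) normalized_sum_cos_tendsto:
  fixes X :: "nat \<Rightarrow> 'a \<Rightarrow> real"
  assumes indep: "indep_vars (\<lambda>_. borel) X UNIV"
    and mean: "\<And>n. expectation (X n) = 0"
    and sq: "\<And>n. integrable M (\<lambda>\<omega>. (X n \<omega>)\<^sup>2)"
    and var: "\<And>n. expectation (\<lambda>\<omega>. (X n \<omega>)\<^sup>2) = s"
    and distr: "\<And>n. distr M borel (X n) = \<mu>"
  shows "(\<lambda>n. expectation (\<lambda>\<omega>. cos ((\<Sum>i<n. X i \<omega>) / sqrt (real n) + b))) \<longlonglongrightarrow> cos b * exp (- s / 2)"
proof -
  have meas [measurable]: "X n \<in> borel_measurable M" for n
    using indep by (simp add: indep_vars_def2)
  have "0 \<le> s" using var[of 0] by (metis Bochner_Integration.integral_nonneg zero_le_power2)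
  then consider "s = 0" | "s > 0" by linarith
  then show ?thesis
  proof cases
    case 1
    have "AE \<omega> in M. (X n \<omega>)\<^sup>2 = 0" for n
      using integral_nonneg_eq_0_iff_AE[OF sq[of n]] var[of n] 1 by simp
    then have zero: "AE \<omega> in M. \<forall>n. X n \<omega> = 0"
      by (simp add: AE_all_countable)
    have "expectation (\<lambda>\<omega>. cos ((\<Sum>i<n. X i \<omega>) / sqrt (real n) + b)) = expectation (\<lambda>\<omega>. cos b)" for n
      using zero by (intro integral_cong_AE) (auto elim!: eventually_mono)
    then show ?thesis using 1 by (simp add: prob_space)
  next
    case 2
    define \<sigma> where "\<sigma> = sqrt s"
    have \<sigma>: "\<sigma> > 0" "\<sigma>\<^sup>2 = s" using 2 by (simp_all add: \<sigma>_def)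
    let ?W = "\<lambda>n \<omega>. (\<Sum>i<n. X i \<omega>) / sqrt (real n * \<sigma>\<^sup>2)"
    have "weak_conv_m (\<lambda>n. distr M borel (?W n)) std_normal_distribution"
      by (rule central_limit_theorem_zero_mean[OF indep mean \<sigma>(1) sq _ distr])
         (simp add: mean var \<sigma>)
    \<comment> \<open>\<open>?W\<close> is standardized, so the scale \<open>\<sigma>\<close> is put
      into the bounded continuous test function.\<close>
    then have "(\<lambda>n. \<integral>y. cos (\<sigma> * y + b) \<partial>distr M borel (?W n))
        \<longlonglongrightarrow> (\<integral>y. cos (\<sigma> * y + b) \<partial>std_normal_distribution)"
      by (rule weak_conv_imp_integral_bdd_continuous_conv[OF real_distribution_distr real_dist_normal_dist, where B = 1, rotated])
         (auto intro!: continuous_intros)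
    moreover have "(\<integral>y. cos (\<sigma> * y + b) \<partial>distr M borel (?W n))
        = expectation (\<lambda>\<omega>. cos ((\<Sum>i<n. X i \<omega>) / sqrt (real n) + b))" for n
    proof -
      have "\<sigma> * ?W n \<omega> = (\<Sum>i<n. X i \<omega>) / sqrt (real n)" for \<omega>
        using \<sigma>(1) by (simp add: real_sqrt_mult)
      then show ?thesis by (subst integral_distr) simp_all
    qed
    ultimately show ?thesis by (simp add: integral_std_normal_cos \<sigma>)
  qed
qed

lemma abs_cos_diff_le: "\<bar>cos x - cos y\<bar> \<le> \<bar>x - y :: real\<bar>"
proof -
  have "\<bar>cos x - cos y\<bar> = 2 * (\<bar>sin ((x + y) / 2)\<bar> * \<bar>sin ((y - x) / 2)\<bar>)"
    by (simp add: cos_diff_cos abs_mult)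
  also have "\<dots> \<le> 2 * (1 * \<bar>(y - x) / 2\<bar>)"
    by (intro mult_left_mono mult_mono abs_sin_le_one abs_sin_x_le_abs_x) auto
  finally show ?thesis by simp
qed

text \<open>The cosine is 1-Lipschitz. The bound carries limits of cosine expectations from one
  sequence of random vectors to another that is close to it in mean.\<close>

lemma (in prob_space) expectation_cos_diff_le:
  fixes Z W :: "'a \<Rightarrow> real ^ 'k"
  assumes [measurable]: "Z \<in> borel_measurable M" "W \<in> borel_measurable M"
    and Z: "\<And>k. integrable M (\<lambda>\<omega>. Z \<omega> $ k)" and W: "\<And>k. integrable M (\<lambda>\<omega>. W \<omega> $ k)"
  shows "\<bar>expectation (\<lambda>\<omega>. cos (t \<bullet> Z \<omega> + b)) - expectation (\<lambda>\<omega>. cos (t \<bullet> W \<omega> + b))\<bar>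
    \<le> (\<Sum>k\<in>UNIV. \<bar>t $ k\<bar> * expectation (\<lambda>\<omega>. \<bar>Z \<omega> $ k - W \<omega> $ k\<bar>))"
proof -
  have int: "integrable M (\<lambda>\<omega>. cos (t \<bullet> V \<omega> + b))" if "V \<in> borel_measurable M" for V
    using integrable_trig_polynomial[OF trig_polynomial.wave[of 1 t b] that] by simp
  have "\<bar>expectation (\<lambda>\<omega>. cos (t \<bullet> Z \<omega> + b)) - expectation (\<lambda>\<omega>. cos (t \<bullet> W \<omega> + b))\<bar>
      = \<bar>expectation (\<lambda>\<omega>. cos (t \<bullet> Z \<omega> + b) - cos (t \<bullet> W \<omega> + b))\<bar>"
    by (simp add: int)
  also have "\<dots> \<le> expectation (\<lambda>\<omega>. \<bar>cos (t \<bullet> Z \<omega> + b) - cos (t \<bullet> W \<omega> + b)\<bar>)"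
    by (rule integral_abs_bound)
  also have "\<dots> \<le> expectation (\<lambda>\<omega>. \<Sum>k\<in>UNIV. \<bar>t $ k\<bar> * \<bar>Z \<omega> $ k - W \<omega> $ k\<bar>)"
  proof (rule integral_mono)
    show "integrable M (\<lambda>\<omega>. \<bar>cos (t \<bullet> Z \<omega> + b) - cos (t \<bullet> W \<omega> + b)\<bar>)"
      by (simp add: int)
    show "integrable M (\<lambda>\<omega>. \<Sum>k\<in>UNIV. \<bar>t $ k\<bar> * \<bar>Z \<omega> $ k - W \<omega> $ k\<bar>)"
      using Z W by simp
    fix \<omega>
    have "\<bar>cos (t \<bullet> Z \<omega> + b) - cos (t \<bullet> W \<omega> + b)\<bar> \<le> \<bar>t \<bullet> (Z \<omega> - W \<omega>)\<bar>"
      using abs_cos_diff_le[of "t \<bullet> Z \<omega> + b" "t \<bullet> W \<omega> + b"] by (simp add: inner_diff_right)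
    also have "\<dots> \<le> (\<Sum>k\<in>UNIV. \<bar>t $ k\<bar> * \<bar>Z \<omega> $ k - W \<omega> $ k\<bar>)"
      unfolding inner_vec_def by (rule order_trans[OF sum_abs]) (simp add: abs_mult)
    finally show "\<bar>cos (t \<bullet> Z \<omega> + b) - cos (t \<bullet> W \<omega> + b)\<bar> \<le> (\<Sum>k\<in>UNIV. \<bar>t $ k\<bar> * \<bar>Z \<omega> $ k - W \<omega> $ k\<bar>)" .
  qed
  also have "\<dots> = (\<Sum>k\<in>UNIV. \<bar>t $ k\<bar> * expectation (\<lambda>\<omega>. \<bar>Z \<omega> $ k - W \<omega> $ k\<bar>))"
    using Z W by simp
  finally show ?thesis .
qed

lemma (in prob_space) expectation_abs_le:
  assumes "U \<in> borel_measurable M" "integrable M (\<lambda>\<omega>. (U \<omega>)\<^sup>2)"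
  shows "expectation (\<lambda>\<omega>. \<bar>U \<omega>\<bar>) \<le> 1 + expectation (\<lambda>\<omega>. (U \<omega> :: real)\<^sup>2)"
proof -
  have int: "integrable M U" by (rule square_integrable_imp_integrable) (use assms in auto)
  have le: "\<bar>u\<bar> \<le> 1 + u\<^sup>2" for u :: real
    using sum_squares_bound[of "\<bar>u\<bar>" 1] abs_ge_zero[of u] unfolding power2_abs by simp
  have "expectation (\<lambda>\<omega>. \<bar>U \<omega>\<bar>) \<le> expectation (\<lambda>\<omega>. 1 + (U \<omega>)\<^sup>2)"
    using int assms(2) by (intro integral_mono le) auto
  then show ?thesis using assms(2) by (simp add: prob_space)
qed

text \<open>Cramer-Wold and Slutsky in one: for each \<open>t\<close> the scalar limit applies to
  \<open>t \<bullet> \<xi> i\<close>, and by \<open>near\<close> the cosine expectations of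
  \<open>Z n\<close> have the same limit as those of the normalized sums.\<close>

theorem (in prob_space) multivariate_clt_perturbed:
  fixes \<xi> Z :: "nat \<Rightarrow> 'a \<Rightarrow> real ^ 'k" and S :: "real ^ 'k ^ 'k"
  assumes indep: "indep_vars (\<lambda>_. borel) \<xi> UNIV"
    and distr: "\<And>n. distr M borel (\<xi> n) = \<mu>"
    and sq: "\<And>n k. integrable M (\<lambda>\<omega>. (\<xi> n \<omega> $ k)\<^sup>2)"
    and mean: "\<And>n k. expectation (\<lambda>\<omega>. \<xi> n \<omega> $ k) = 0"
    and cov: "\<And>n k l. expectation (\<lambda>\<omega>. \<xi> n \<omega> $ k * \<xi> n \<omega> $ l) = S $ k $ l"
    and Z: "\<And>n. Z n \<in> borel_measurable M" and Z_int: "\<And>n k. integrable M (\<lambda>\<omega>. Z n \<omega> $ k)"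
    and near: "\<And>k. (\<lambda>n. expectation (\<lambda>\<omega>. \<bar>Z n \<omega> $ k - (\<Sum>i<n. \<xi> i \<omega> $ k) / sqrt (real n)\<bar>)) \<longlonglongrightarrow> 0"
  shows "\<exists>N. is_multivariate_normal 0 S N \<and> converges_in_distribution M Z N"
proof -
  have meas [measurable]: "\<xi> n \<in> borel_measurable M" for n
    using indep by (simp add: indep_vars_def2)
  have int1: "integrable M (\<lambda>\<omega>. \<xi> n \<omega> $ k)" for n k
    by (rule square_integrable_imp_integrable) (use sq in auto)
  have int2: "integrable M (\<lambda>\<omega>. \<xi> n \<omega> $ k * \<xi> n \<omega> $ l)" for n k l
    by (rule integrable_mult_if_square_integrable) (use sq in auto)
  have quad: "(t \<bullet> \<xi> n \<omega>)\<^sup>2 = (\<Sum>k\<in>UNIV. \<Sum>l\<in>UNIV. t $ k * t $ l * (\<xi> n \<omega> $ k * \<xi> n \<omega> $ l))" for t n \<omega>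
    by (simp add: inner_vec_def power2_eq_square sum_product mult_ac)
  have quad_int: "integrable M (\<lambda>\<omega>. (t \<bullet> \<xi> n \<omega>)\<^sup>2)" for t n
    unfolding quad using int2 by simp
  have quad_exp: "expectation (\<lambda>\<omega>. (t \<bullet> \<xi> n \<omega>)\<^sup>2) = (\<Sum>k\<in>UNIV. \<Sum>l\<in>UNIV. t $ k * t $ l * S $ k $ l)" for t n
    unfolding quad using int2 by (simp add: cov)
  \<comment> \<open>\<open>S\<close> is positive semidefinite because its quadratic form at
    \<open>t\<close> is the second moment of \<open>t \<bullet> \<xi> 0\<close>.\<close>
  obtain A :: "real ^ 'k ^ 'k" where A: "A ** transpose A = S"
  proof (rule psd_matrix_factorization[of S])
    show "S $ k $ l = S $ l $ k" for k l
      unfolding cov[of 0 k l, symmetric] cov[of 0 l k, symmetric] by (simp add: mult.commute)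
    have "0 \<le> expectation (\<lambda>\<omega>. (t \<bullet> \<xi> 0 \<omega>)\<^sup>2)" for t by simp
    then have "0 \<le> (\<Sum>k\<in>UNIV. \<Sum>l\<in>UNIV. t $ k * t $ l * S $ k $ l)" for t
      unfolding quad_exp .
    from this[of "\<chi> k. x k" for x] show "0 \<le> (\<Sum>k\<in>UNIV. \<Sum>l\<in>UNIV. x k * x l * S $ k $ l)" for x
      by simp
  qed
  define N where "N = distr (\<Pi>\<^sub>M i\<in>(UNIV :: 'k set). density lborel std_normal_density) borel
              (\<lambda>z. 0 + A *v (\<chi> i. z i))"
  have N: "is_multivariate_normal 0 S N"
    unfolding is_multivariate_normal_def N_def using A by blast
  note N_props = multivariate_normal_properties[OF N]
  define W where "W n \<omega> = (\<chi> k. (\<Sum>i<n. \<xi> i \<omega> $ k) / sqrt (real n))" for n \<omega>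
  have W [measurable]: "W n \<in> borel_measurable M" for n
    unfolding W_def by (intro borel_measurable_vec_lambda) simp
  have W_int: "integrable M (\<lambda>\<omega>. W n \<omega> $ k)" for n k
    unfolding W_def using int1 by simp
  have W_conv: "(\<lambda>n. expectation (\<lambda>\<omega>. cos (t \<bullet> W n \<omega> + b))) \<longlonglongrightarrow> cos b * exp (- (t \<bullet> (S *v t)) / 2)" for t b
  proof -
    have "(\<lambda>n. expectation (\<lambda>\<omega>. cos ((\<Sum>i<n. t \<bullet> \<xi> i \<omega>) / sqrt (real n) + b)))
        \<longlonglongrightarrow> cos b * exp (- (\<Sum>k\<in>UNIV. \<Sum>l\<in>UNIV. t $ k * t $ l * S $ k $ l) / 2)"
    proof (rule normalized_sum_cos_tendsto)
      show "indep_vars (\<lambda>_. borel) (\<lambda>i \<omega>. t \<bullet> \<xi> i \<omega>) UNIV"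
        by (rule indep_vars_compose2[OF indep]) simp
      show "expectation (\<lambda>\<omega>. t \<bullet> \<xi> n \<omega>) = 0" for n
        unfolding inner_vec_def using int1 by (simp add: mean)
      show "distr M borel (\<lambda>\<omega>. t \<bullet> \<xi> n \<omega>) = distr \<mu> borel (\<lambda>x. t \<bullet> x)" for n
        unfolding distr[of n, symmetric] by (subst distr_distr) (simp_all add: comp_def)
    qed (fact quad_int quad_exp)+
    moreover have "(\<Sum>i<n. t \<bullet> \<xi> i \<omega>) / sqrt (real n) = t \<bullet> W n \<omega>" for n \<omega>
    proof -
      have "(\<Sum>i<n. t \<bullet> \<xi> i \<omega>) = (\<Sum>k\<in>UNIV. t $ k * (\<Sum>i<n. \<xi> i \<omega> $ k))"
        unfolding inner_vec_def inner_real_def sum_distrib_left by (rule sum.swap)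
      then show ?thesis
        by (simp add: W_def inner_vec_def sum_divide_distrib[where A = UNIV])
    qed
    moreover have "(\<Sum>k\<in>UNIV. \<Sum>l\<in>UNIV. t $ k * t $ l * S $ k $ l) = t \<bullet> (S *v t)"
      by (simp add: inner_vec_def matrix_vector_mult_def sum_distrib_left mult_ac)
    ultimately show ?thesis by simp
  qed
  have near': "(\<lambda>n. expectation (\<lambda>\<omega>. \<bar>Z n \<omega> $ k - W n \<omega> $ k\<bar>)) \<longlonglongrightarrow> 0" for k
    using near[of k] by (simp add: W_def)
  have Z_conv: "(\<lambda>n. expectation (\<lambda>\<omega>. cos (t \<bullet> Z n \<omega> + b))) \<longlonglongrightarrow> (\<integral>x. cos (t \<bullet> x + b) \<partial>N)" for t b
  proof -
    have "(\<lambda>n. \<Sum>k\<in>UNIV. \<bar>t $ k\<bar> * expectation (\<lambda>\<omega>. \<bar>Z n \<omega> $ k - W n \<omega> $ k\<bar>)) \<longlonglongrightarrow> (\<Sum>k\<in>UNIV. \<bar>t $ k\<bar> * 0)"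
      by (intro tendsto_sum tendsto_mult tendsto_const near')
    then have "(\<lambda>n. \<Sum>k\<in>UNIV. \<bar>t $ k\<bar> * expectation (\<lambda>\<omega>. \<bar>Z n \<omega> $ k - W n \<omega> $ k\<bar>)) \<longlonglongrightarrow> 0"
      by simp
    then have "(\<lambda>n. expectation (\<lambda>\<omega>. cos (t \<bullet> Z n \<omega> + b)) - expectation (\<lambda>\<omega>. cos (t \<bullet> W n \<omega> + b))) \<longlonglongrightarrow> 0"
      by (rule Lim_null_comparison[rotated])
         (simp add: expectation_cos_diff_le[OF Z W Z_int W_int])
    from tendsto_add[OF this W_conv[of t b]] show ?thesis
      by (simp add: N_props(4))
  qed
  \<comment> \<open>Split \<open>Z n\<close> into \<open>Z n - W n\<close> and \<open>W n\<close>: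
    the first part eventually has absolute moment below 1, and component \<open>k\<close> of
    \<open>W n\<close> has second moment \<open>S $ k $ k\<close> for \<open>n > 0\<close>. Summing
    over all diagonal entries makes the bound the same for every \<open>k\<close>.\<close>
  have "\<forall>\<^sub>F n in sequentially. expectation (\<lambda>\<omega>. \<bar>Z n \<omega> $ k\<bar>) \<le> 2 + (\<Sum>k\<in>UNIV. \<bar>S $ k $ k\<bar>)" for k
  proof -
    have "\<forall>\<^sub>F n in sequentially. expectation (\<lambda>\<omega>. \<bar>Z n \<omega> $ k - W n \<omega> $ k\<bar>) < 1"
      using near'[of k] by (rule order_tendstoD) simp
    then show ?thesis
      using eventually_gt_at_top[of 0]
    proof eventually_elim
      case (elim n)
      have comp: "indep_vars (\<lambda>_. borel) (\<lambda>i \<omega>. \<xi> i \<omega> $ k) {..<n}"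
        by (rule indep_vars_compose2[OF indep_vars_subset[OF indep]]) auto
      have sm: "integrable M (\<lambda>\<omega>. (\<Sum>i<n. \<xi> i \<omega> $ k)\<^sup>2)"
        "expectation (\<lambda>\<omega>. (\<Sum>i<n. \<xi> i \<omega> $ k)\<^sup>2) = real n * S $ k $ k"
        using second_moment_sum[OF _ comp sq mean] by (simp_all add: power2_eq_square cov)
      have "expectation (\<lambda>\<omega>. \<bar>W n \<omega> $ k\<bar>) \<le> 1 + expectation (\<lambda>\<omega>. (W n \<omega> $ k)\<^sup>2)"
        by (rule expectation_abs_le) (use sm(1) in \<open>simp_all add: W_def power_divide\<close>)
      also have "\<dots> = 1 + S $ k $ k"
        using elim(2) sm by (simp add: W_def power_divide)
      also have "\<dots> \<le> 1 + (\<Sum>k\<in>UNIV. \<bar>S $ k $ k\<bar>)"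
        using member_le_sum[of k UNIV "\<lambda>k. \<bar>S $ k $ k\<bar>"] by simp
      finally have "expectation (\<lambda>\<omega>. \<bar>W n \<omega> $ k\<bar>) \<le> 1 + (\<Sum>k\<in>UNIV. \<bar>S $ k $ k\<bar>)" .
      moreover have "expectation (\<lambda>\<omega>. \<bar>Z n \<omega> $ k\<bar>)
          \<le> expectation (\<lambda>\<omega>. \<bar>Z n \<omega> $ k - W n \<omega> $ k\<bar> + \<bar>W n \<omega> $ k\<bar>)"
        using Z_int W_int by (intro integral_mono) auto
      moreover have "\<dots> = expectation (\<lambda>\<omega>. \<bar>Z n \<omega> $ k - W n \<omega> $ k\<bar>) + expectation (\<lambda>\<omega>. \<bar>W n \<omega> $ k\<bar>)"
        using Z_int W_int by simp
      ultimately show ?case using elim(1) by linarith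
    qed
  qed
  with N Z Z_int Z_conv show ?thesis
    using converges_in_distribution_if_trig_converges[OF prob_space_axioms N_props(1,2)] N_props(3)
    by blast
qed

subsection \<open>The statistic \<open>T\<^sub>n\<close>\<close>

text \<open>The sample is indexed from 1, the sums of the limit theorem from 0. The product rule
  over \<open>J\<close> for the shifted family is the one over the image of \<open>J\<close> under
  \<open>Suc\<close> for the original family, with \<open>A (j - 1)\<close> undoing the
  shift.\<close>

lemma (in prob_space) indep_vars_Suc:
  assumes "indep_vars (\<lambda>_. N) X {1..}"
  shows "indep_vars (\<lambda>_. N) (\<lambda>i. X (Suc i)) UNIV"
proof -
  let ?F = "\<lambda>i. {X i -` A \<inter> space M | A. A \<in> sets N}"
  have meas: "random_variable N (X i)" if "i \<ge> 1" for i
    using assms that by (auto simp: indep_vars_def2)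
  have sets: "indep_sets ?F {1..}"
    using assms by (simp add: indep_vars_def2)
  have "indep_sets (\<lambda>i. ?F (Suc i)) UNIV"
  proof (rule indep_setsI)
    show "?F (Suc i) \<subseteq> events" for i
      using meas[of "Suc i"] by auto
    fix A and J :: "nat set"
    assume J: "J \<noteq> {}" "finite J" and A: "\<forall>j\<in>J. A j \<in> ?F (Suc j)"
    have "prob (\<Inter>j\<in>Suc ` J. A (j - 1)) = (\<Prod>j\<in>Suc ` J. prob (A (j - 1)))"
      using J A by (intro indep_setsD[OF sets]) auto
    then show "prob (\<Inter>j\<in>J. A j) = (\<Prod>j\<in>J. prob (A j))"
      by (simp add: prod.reindex)
  qed
  then show ?thesis
    using meas by (simp add: indep_vars_def2)
qed

text \<open>Turns MCAR, which concerns vectors of different types, into independence of functions of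
  these vectors with a common value type. Preimages under a composition are among those of the inner
  map, and the families are closed under intersection, so independence extends to the generated
  sigma-algebras.\<close>

lemma (in prob_space) indep_var_if_indep_set_vimage:
  assumes indep: "indep_set {Q -` B \<inter> space M | B. B \<in> sets N} {Q' -` B \<inter> space M | B. B \<in> sets N'}"
    and Q: "Q \<in> measurable M N" and Q': "Q' \<in> measurable M N'"
    and \<phi>: "\<phi> \<in> measurable N L" and \<psi>: "\<psi> \<in> measurable N' L'"
  shows "indep_var L (\<lambda>\<omega>. \<phi> (Q \<omega>)) L' (\<lambda>\<omega>. \<psi> (Q' \<omega>))"
proof -
  have sub: "{(\<lambda>\<omega>. h (U \<omega>)) -` A \<inter> space M | A. A \<in> sets K'} \<subseteq> {U -` B \<inter> space M | B. B \<in> sets K}"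
    if "U \<in> measurable M K" "h \<in> measurable K K'" for U h K K'
  proof clarify
    fix A assume "A \<in> sets K'"
    then have "h -` A \<inter> space K \<in> sets K" using that(2) by (rule measurable_sets[rotated])
    moreover have "(\<lambda>\<omega>. h (U \<omega>)) -` A \<inter> space M = U -` (h -` A \<inter> space K) \<inter> space M"
      using measurable_space[OF that(1)] by auto
    ultimately show "\<exists>B. (\<lambda>\<omega>. h (U \<omega>)) -` A \<inter> space M = U -` B \<inter> space M \<and> B \<in> sets K"
      by blast
  qed
  have stable: "Int_stable {U -` A \<inter> space M | A. A \<in> sets K}" for U and K :: "'k measure"
  proof (rule Int_stableI)
    fix a b assume "a \<in> {U -` A \<inter> space M | A. A \<in> sets K}" "b \<in> {U -` A \<inter> space M | A. A \<in> sets K}"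
    then obtain A B where "A \<in> sets K" "B \<in> sets K" "a = U -` A \<inter> space M" "b = U -` B \<inter> space M" by auto
    then have "a \<inter> b = U -` (A \<inter> B) \<inter> space M" "A \<inter> B \<in> sets K" by auto
    then show "a \<inter> b \<in> {U -` A \<inter> space M | A. A \<in> sets K}" by blast
  qed
  have "indep_set {(\<lambda>\<omega>. \<phi> (Q \<omega>)) -` A \<inter> space M | A. A \<in> sets L} {(\<lambda>\<omega>. \<psi> (Q' \<omega>)) -` A \<inter> space M | A. A \<in> sets L'}"
    using indep sub[OF Q \<phi>] sub[OF Q' \<psi>] unfolding indep_sets2_eq by (meson subset_iff subset_trans)
  then show ?thesis
    unfolding indep_var_eq
    using measurable_compose[OF Q \<phi>] measurable_compose[OF Q' \<psi>]
    by (intro conjI indep_set_sigma_sets stable) auto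
qed

text \<open>\<open>T_stat\<close> is minus the sample covariance with divisor \<open>n - 1\<close>,
  hence invariant under shifts of either variable. The constants \<open>a\<close> and
  \<open>c\<close> are arbitrary here and later become the means.\<close>

lemma T_stat_centered:
  assumes "n \<ge> 2"
  shows "T_stat x r n u v = ((\<Sum>i=1..n. x i $ u - a) * (\<Sum>i=1..n. r i $ v - c) / real n
      - (\<Sum>i=1..n. (x i $ u - a) * (r i $ v - c))) / (real n - 1)"
proof -
  let ?A = "\<Sum>i=1..n. x i $ u" and ?B = "\<Sum>i=1..n. r i $ v" and ?C = "\<Sum>i=1..n. x i $ u * r i $ v"
  \<comment> \<open>With the diagonal added, the double sum is a product of two single sums.\<close>
  have "(\<Sum>i=1..n. \<Sum>j\<in>{1..n} - {i}. x i $ u * r j $ v) = (\<Sum>i=1..n. x i $ u * ?B - x i $ u * r i $ v)"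
    by (intro sum.cong refl) (simp add: sum_distrib_left[symmetric] sum_diff1 right_diff_distrib)
  also have "\<dots> = ?A * ?B - ?C" by (simp add: sum_subtractf sum_distrib_right)
  finally have offdiag: "(\<Sum>i=1..n. \<Sum>j\<in>{1..n} - {i}. x i $ u * r j $ v) = ?A * ?B - ?C" .
  have centered: "(\<Sum>i=1..n. (x i $ u - a) * (r i $ v - c)) = ?C - c * ?A - a * ?B + real n * a * c"
    by (simp add: algebra_simps sum.distrib sum_subtractf sum_distrib_left)
  have n: "real n \<noteq> 0" "real n - 1 \<noteq> 0" using assms by auto
  show ?thesis
    unfolding T_stat_def offdiag centered using n by (simp add: sum_subtractf) (simp add: field_simps)
qed

lemma integral_eq_if_distr_eq:
  fixes h :: "'c \<Rightarrow> real"
  assumes "distr M N V = distr P N U" "V \<in> measurable M N" "U \<in> measurable P N" "h \<in> borel_measurable N"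
  shows "integrable M (\<lambda>\<omega>. h (V \<omega>)) \<longleftrightarrow> integrable P (\<lambda>\<omega>. h (U \<omega>))"
    and "(\<integral>\<omega>. h (V \<omega>) \<partial>M) = (\<integral>\<omega>. h (U \<omega>) \<partial>P)"
  using assms by (metis integrable_distr_eq, metis integral_distr)

text \<open>Coordinates are indexed by pairs, which stand for the positions in the lexicographic
  order. The existence of \<open>N\<close> includes that the product matrix is positive
  semidefinite.\<close>

theorem theorem4:
  fixes P :: "'a measure" and M :: "'b measure"
    and X :: "'a \<Rightarrow> real ^ 'p" and Y R :: "'a \<Rightarrow> real ^ 'q"
    and Xs :: "nat \<Rightarrow> 'b \<Rightarrow> real ^ 'p" and Ys Rs :: "nat \<Rightarrow> 'b \<Rightarrow> real ^ 'q"
  assumes "prob_space P" and "prob_space M"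
    and "(\<lambda>\<omega>. (X \<omega>, Y \<omega>, R \<omega>)) \<in> borel_measurable P"
    and "\<And>\<omega> v. \<omega> \<in> space P \<Longrightarrow> R \<omega> $ v \<in> {0, 1}"
    and "\<And>u. integrable P (\<lambda>\<omega>. (X \<omega> $ u)\<^sup>2)"
    and "MCAR P X Y R"
    and "prob_space.indep_vars M (\<lambda>_. borel) (\<lambda>i \<omega>. (Xs i \<omega>, Ys i \<omega>, Rs i \<omega>)) {1..}"
    and "\<And>i. i \<ge> 1 \<Longrightarrow>
           distr M borel (\<lambda>\<omega>. (Xs i \<omega>, Ys i \<omega>, Rs i \<omega>)) =
           distr P borel (\<lambda>\<omega>. (X \<omega>, Y \<omega>, R \<omega>))"
  shows "\<exists>N. is_multivariate_normal 0
               (\<chi> k l :: 'p \<times> 'q.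
                  covariance P (\<lambda>\<omega>. X \<omega> $ fst k) (\<lambda>\<omega>. X \<omega> $ fst l) *
                  covariance P (\<lambda>\<omega>. R \<omega> $ snd k) (\<lambda>\<omega>. R \<omega> $ snd l)) N \<and>
             converges_in_distribution M
               (\<lambda>n \<omega>. \<chi> k :: 'p \<times> 'q.
                  sqrt (real n) * T_stat (\<lambda>i. Xs i \<omega>) (\<lambda>i. Rs i \<omega>) n (fst k) (snd k)) N"
proof -
  interpret P: prob_space P by fact
  interpret M: prob_space M by fact
  \<comment> \<open>The sample is handled through triples, so that equality of their laws with that
    of \<open>U\<close> transfers moments from \<open>P\<close> to \<open>M\<close>.\<close>
  define V where "V i \<omega> = (Xs i \<omega>, Ys i \<omega>, Rs i \<omega>)" for i \<omega>
  define U where "U \<omega> = (X \<omega>, Y \<omega>, R \<omega>)" for \<omega>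
  have U [measurable]: "U \<in> borel_measurable P"
    using assms(3) by (simp add: U_def[abs_def])
  have V_indep: "M.indep_vars (\<lambda>_. borel) V {1..}"
    using assms(7) by (simp add: V_def[abs_def])
  then have V: "V i \<in> borel_measurable M" if "i \<ge> 1" for i
    using that by (auto simp: M.indep_vars_def2)
  have V_distr: "distr M borel (V i) = distr P borel U" if "i \<ge> 1" for i
    using assms(8)[OF that] by (simp add: V_def[abs_def] U_def[abs_def])
  have RXY: "R \<in> borel_measurable P" "(\<lambda>\<omega>. (X \<omega>, Y \<omega>)) \<in> borel_measurable P"
    "P.indep_set {R -` B \<inter> space P | B. B \<in> sets borel}
       {(\<lambda>\<omega>. (X \<omega>, Y \<omega>)) -` C \<inter> space P | C. C \<in> sets borel}"
    using assms(6) by (auto simp: MCAR_def)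

  define mx where "mx u = (\<integral>\<omega>. X \<omega> $ u \<partial>P)" for u
  define mr where "mr v = (\<integral>\<omega>. R \<omega> $ v \<partial>P)" for v
  \<comment> \<open>The centered coordinates are functions of a triple, not of an outcome, so that
    the same \<open>f\<close> and \<open>g\<close> apply to \<open>U\<close> under \<open>P\<close>
    and to \<open>V i\<close> under \<open>M\<close>.\<close>
  define f where "f u z = fst z $ u - mx u" for u and z :: "(real ^ 'p) \<times> (real ^ 'q) \<times> (real ^ 'q)"
  define g where "g v z = snd (snd z) $ v - mr v" for v and z :: "(real ^ 'p) \<times> (real ^ 'q) \<times> (real ^ 'q)"
  have x_borel [measurable]: "(\<lambda>z :: (real ^ 'p) \<times> (real ^ 'q) \<times> (real ^ 'q). fst z $ u) \<in> borel_measurable borel" for u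
    by (intro borel_measurable_continuous_onI continuous_intros)
  have r_borel [measurable]: "(\<lambda>z :: (real ^ 'p) \<times> (real ^ 'q) \<times> (real ^ 'q). snd (snd z) $ v) \<in> borel_measurable borel" for v
    by (intro borel_measurable_continuous_onI continuous_intros)
  have f_borel [measurable]: "f u \<in> borel_measurable borel" for u
    unfolding f_def[abs_def] by measurable
  have g_borel [measurable]: "g v \<in> borel_measurable borel" for v
    unfolding g_def[abs_def] by measurable

  have X_meas [measurable]: "(\<lambda>\<omega>. X \<omega> $ u) \<in> borel_measurable P" for u
    using measurable_compose[OF U x_borel] by (simp add: U_def)
  have R_meas [measurable]: "(\<lambda>\<omega>. R \<omega> $ v) \<in> borel_measurable P" for v
    using measurable_compose[OF U r_borel] by (simp add: U_def)
  have X_int: "integrable P (\<lambda>\<omega>. X \<omega> $ u)" for u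
    by (rule P.square_integrable_imp_integrable) (use assms(5) in auto)
  have R_bound: "\<bar>R \<omega> $ v\<bar> \<le> 1" if "\<omega> \<in> space P" for \<omega> v
    using assms(4)[OF that, of v] by auto
  have R_int: "integrable P (\<lambda>\<omega>. R \<omega> $ v)" for v
    by (rule P.integrable_const_bound[where B = 1]) (use R_bound in auto)
  have R_sq: "integrable P (\<lambda>\<omega>. (R \<omega> $ v)\<^sup>2)" for v
    by (rule P.integrable_const_bound[where B = 1]) (use R_bound in \<open>auto simp: abs_square_le_1\<close>)
  have f_sq: "integrable P (\<lambda>\<omega>. (f u (U \<omega>))\<^sup>2)" for u
    using assms(5)[of u] X_int[of u] by (simp add: f_def U_def power2_diff)
  have g_sq: "integrable P (\<lambda>\<omega>. (g v (U \<omega>))\<^sup>2)" for v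
    using R_sq[of v] R_int[of v] by (simp add: g_def U_def power2_diff)
  have f_mean: "(\<integral>\<omega>. f u (U \<omega>) \<partial>P) = 0" for u
    using X_int[of u] by (simp add: f_def U_def mx_def P.prob_space)
  have g_mean: "(\<integral>\<omega>. g v (U \<omega>) \<partial>P) = 0" for v
    using R_int[of v] by (simp add: g_def U_def mr_def P.prob_space)
  have f_int: "integrable P (\<lambda>\<omega>. f u (U \<omega>))" for u
    using X_int[of u] by (simp add: f_def U_def)
  have g_int: "integrable P (\<lambda>\<omega>. g v (U \<omega>))" for v
    using R_int[of v] by (simp add: g_def U_def)
  have ff_int: "integrable P (\<lambda>\<omega>. f u (U \<omega>) * f u' (U \<omega>))" for u u'
    by (rule integrable_mult_if_square_integrable) (use f_sq in auto)
  have gg_int: "integrable P (\<lambda>\<omega>. g v (U \<omega>) * g v' (U \<omega>))" for v v'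
    by (rule integrable_mult_if_square_integrable) (use g_sq in auto)

  \<comment> \<open>MCAR concerns the pair of \<open>X\<close> and \<open>Y\<close>, so
    \<open>\<psi>\<close> is composed with the first projection.\<close>
  have indep: "P.indep_var borel (\<lambda>\<omega>. \<phi> (R \<omega>)) borel (\<lambda>\<omega>. \<psi> (X \<omega>))"
    if "\<phi> \<in> borel_measurable borel" "\<psi> \<in> borel_measurable borel"
    for \<phi> :: "real ^ 'q \<Rightarrow> real" and \<psi> :: "real ^ 'p \<Rightarrow> real"
  proof -
    have "(\<lambda>z :: (real ^ 'p) \<times> (real ^ 'q). fst z) \<in> borel_measurable borel"
      by (intro borel_measurable_continuous_onI continuous_intros)
    from measurable_compose[OF this that(2)]
    have "(\<lambda>z :: (real ^ 'p) \<times> (real ^ 'q). \<psi> (fst z)) \<in> borel_measurable borel" .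
    from P.indep_var_if_indep_set_vimage[OF RXY(3,1,2) that(1) this] show ?thesis by simp
  qed
  have fg_indep: "P.indep_var borel (\<lambda>\<omega>. g v (U \<omega>)) borel (\<lambda>\<omega>. f u (U \<omega>))" for u v
    using indep[of "\<lambda>r. r $ v - mr v" "\<lambda>x. x $ u - mx u"] by (simp add: f_def g_def U_def)
  have ffgg_indep: "P.indep_var borel (\<lambda>\<omega>. g v (U \<omega>) * g v' (U \<omega>)) borel (\<lambda>\<omega>. f u (U \<omega>) * f u' (U \<omega>))" for u u' v v'
    using indep[of "\<lambda>r. (r $ v - mr v) * (r $ v' - mr v')" "\<lambda>x. (x $ u - mx u) * (x $ u' - mx u')"]
    by (simp add: f_def g_def U_def)

  \<comment> \<open>The summand of the leading term. Its minus sign is that of the sum of products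
    in \<open>T_stat_centered\<close>; it cancels in the covariances.\<close>
  define \<eta> where "\<eta> z = (\<chi> k :: 'p \<times> 'q. - (f (fst k) z * g (snd k) z))" for z
  have \<eta>_borel [measurable]: "\<eta> \<in> borel_measurable borel"
    unfolding \<eta>_def[abs_def] by (intro borel_measurable_vec_lambda) simp
  define \<Sigma> where "\<Sigma> = (\<chi> k l :: 'p \<times> 'q.
                  covariance P (\<lambda>\<omega>. X \<omega> $ fst k) (\<lambda>\<omega>. X \<omega> $ fst l) *
                  covariance P (\<lambda>\<omega>. R \<omega> $ snd k) (\<lambda>\<omega>. R \<omega> $ snd l))"
  have \<eta>_mean: "(\<integral>\<omega>. \<eta> (U \<omega>) $ k \<partial>P) = 0" for k
    using P.indep_var_lebesgue_integral[OF fg_indep g_int f_int] by (simp add: \<eta>_def f_mean mult.commute)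
  have \<eta>\<eta>: "\<eta> z $ k * \<eta> z $ l = g (snd k) z * g (snd l) z * (f (fst k) z * f (fst l) z)" for z k l
    by (simp add: \<eta>_def mult_ac)
  have \<eta>_cov: "(\<integral>\<omega>. \<eta> (U \<omega>) $ k * \<eta> (U \<omega>) $ l \<partial>P) = \<Sigma> $ k $ l" for k l
    unfolding \<eta>\<eta> P.indep_var_lebesgue_integral[OF ffgg_indep gg_int ff_int]
    by (simp add: \<Sigma>_def covariance_def f_def g_def U_def mx_def mr_def)
  \<comment> \<open>Independence separates the factors built from \<open>R\<close> from those built
    from \<open>X\<close>, so square integrability of each centered coordinate suffices.\<close>
  have \<eta>_sq: "integrable P (\<lambda>\<omega>. (\<eta> (U \<omega>) $ k)\<^sup>2)" for k
    unfolding power2_eq_square \<eta>\<eta> by (rule P.indep_var_integrable[OF ffgg_indep gg_int ff_int])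

  \<comment> \<open>Transfer from the generic vector to the sample\<close>
  note transfer = integral_eq_if_distr_eq[OF V_distr V U]
  have VSuc_indep: "M.indep_vars (\<lambda>_. borel) (\<lambda>i. V (Suc i)) UNIV"
    by (rule M.indep_vars_Suc[OF V_indep])
  have Xs_sq: "integrable M (\<lambda>\<omega>. (Xs i \<omega> $ u)\<^sup>2)" and Rs_sq: "integrable M (\<lambda>\<omega>. (Rs i \<omega> $ v)\<^sup>2)"
    and Xs_meas: "(\<lambda>\<omega>. Xs i \<omega> $ u) \<in> borel_measurable M" and Rs_meas: "(\<lambda>\<omega>. Rs i \<omega> $ v) \<in> borel_measurable M"
    if "i \<ge> 1" for i u v
    using transfer(1)[OF that that, of "\<lambda>z. (fst z $ u)\<^sup>2"] transfer(1)[OF that that, of "\<lambda>z. (snd (snd z) $ v)\<^sup>2"]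
      assms(5)[of u] R_sq[of v] measurable_compose[OF V[OF that] x_borel[of u]] measurable_compose[OF V[OF that] r_borel[of v]]
    by (simp_all add: V_def U_def)
  define Z where "Z n \<omega> = (\<chi> k :: 'p \<times> 'q.
                  sqrt (real n) * T_stat (\<lambda>i. Xs i \<omega>) (\<lambda>i. Rs i \<omega>) n (fst k) (snd k))" for n \<omega>
  have T_int: "integrable M (\<lambda>\<omega>. T_stat (\<lambda>i. Xs i \<omega>) (\<lambda>i. Rs i \<omega>) n u v)" for n u v
    unfolding T_stat_def
    by (intro Bochner_Integration.integrable_diff integrable_mult_right Bochner_Integration.integrable_sum
        integrable_mult_if_square_integrable Xs_sq Rs_sq Xs_meas Rs_meas) auto
  have Z_int: "integrable M (\<lambda>\<omega>. Z n \<omega> $ k)" for n k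
    using T_int by (simp add: Z_def)
  have Z_meas: "Z n \<in> borel_measurable M" for n
    unfolding Z_def[abs_def] using T_int by (intro borel_measurable_vec_lambda) auto
  have near: "(\<lambda>n. M.expectation (\<lambda>\<omega>. \<bar>Z n \<omega> $ k - (\<Sum>i<n. \<eta> (V (Suc i) \<omega>) $ k) / sqrt (real n)\<bar>)) \<longlonglongrightarrow> 0" for k
  proof -
    let ?u = "fst k" and ?v = "snd k"
    define c where "c = (\<integral>\<omega>. (f ?u (U \<omega>))\<^sup>2 \<partial>P) + (\<integral>\<omega>. (g ?v (U \<omega>))\<^sup>2 \<partial>P)"
    \<comment> \<open>The squared sums of the centered coordinates contribute \<open>c * n\<close>
      in expectation, and so do the diagonal terms, whence the factor 2. The denominator is of order
      \<open>n\<close> to the power 3/2.\<close>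
    have bound: "M.expectation (\<lambda>\<omega>. \<bar>Z n \<omega> $ k - (\<Sum>i<n. \<eta> (V (Suc i) \<omega>) $ k) / sqrt (real n)\<bar>)
        \<le> 2 * c * (real n / (sqrt (real n) * (real n - 1)))" if n: "n \<ge> 2" for n
    proof -
      let ?A = "\<lambda>\<omega>. \<Sum>i=1..n. f ?u (V i \<omega>)" and ?B = "\<lambda>\<omega>. \<Sum>i=1..n. g ?v (V i \<omega>)"
        and ?C = "\<lambda>\<omega>. \<Sum>i=1..n. f ?u (V i \<omega>) * g ?v (V i \<omega>)"
      let ?D = "\<lambda>\<omega>. (?A \<omega>)\<^sup>2 + (?B \<omega>)\<^sup>2 + (\<Sum>i=1..n. (f ?u (V i \<omega>))\<^sup>2 + (g ?v (V i \<omega>))\<^sup>2)"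
      let ?d = "sqrt (real n) * (real n - 1)"
      have sum2: "integrable M (\<lambda>\<omega>. (\<Sum>i=1..n. h (V i \<omega>))\<^sup>2)" "integrable M (\<lambda>\<omega>. \<Sum>i=1..n. (h (V i \<omega>))\<^sup>2)"
        "M.expectation (\<lambda>\<omega>. (\<Sum>i=1..n. h (V i \<omega>))\<^sup>2) = real n * (\<integral>\<omega>. (h (U \<omega>))\<^sup>2 \<partial>P)"
        "M.expectation (\<lambda>\<omega>. \<Sum>i=1..n. (h (V i \<omega>))\<^sup>2) = real n * (\<integral>\<omega>. (h (U \<omega>))\<^sup>2 \<partial>P)"
        if h: "h \<in> borel_measurable borel" "integrable P (\<lambda>\<omega>. (h (U \<omega>))\<^sup>2)" "(\<integral>\<omega>. h (U \<omega>) \<partial>P) = 0" for h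
      proof -
        have tr: "integrable M (\<lambda>\<omega>. (h (V i \<omega>))\<^sup>2)" "M.expectation (\<lambda>\<omega>. h (V i \<omega>)) = 0"
          "M.expectation (\<lambda>\<omega>. (h (V i \<omega>))\<^sup>2) = (\<integral>\<omega>. (h (U \<omega>))\<^sup>2 \<partial>P)" if "i \<in> {1..n}" for i
          using that h transfer[of i "\<lambda>z. (h z)\<^sup>2"] transfer(2)[of i h] by simp_all
        have "M.indep_vars (\<lambda>_. borel) (\<lambda>i \<omega>. h (V i \<omega>)) {1..n}"
          by (rule M.indep_vars_compose2[OF M.indep_vars_subset[OF V_indep]]) (use h in auto)
        from M.second_moment_sum[OF _ this tr(1,2)]
        show "integrable M (\<lambda>\<omega>. (\<Sum>i=1..n. h (V i \<omega>))\<^sup>2)"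
          "M.expectation (\<lambda>\<omega>. (\<Sum>i=1..n. h (V i \<omega>))\<^sup>2) = real n * (\<integral>\<omega>. (h (U \<omega>))\<^sup>2 \<partial>P)"
          by (simp_all add: tr)
        show "integrable M (\<lambda>\<omega>. \<Sum>i=1..n. (h (V i \<omega>))\<^sup>2)"
          using tr(1) by (intro Bochner_Integration.integrable_sum) auto
        show "M.expectation (\<lambda>\<omega>. \<Sum>i=1..n. (h (V i \<omega>))\<^sup>2) = real n * (\<integral>\<omega>. (h (U \<omega>))\<^sup>2 \<partial>P)"
          using tr by (subst Bochner_Integration.integral_sum) auto
      qed
      note fsum = sum2[OF f_borel f_sq f_mean, of ?u] and gsum = sum2[OF g_borel g_sq g_mean, of ?v]
      have d: "?d > 0" using n by simp
      \<comment> \<open>The coefficient of \<open>?C\<close> is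
        \<open>- sqrt n / (n - 1) + 1 / sqrt n\<close>, which collapses to \<open>- 1 / ?d\<close>:
        the leading parts cancel.\<close>
      have diff: "Z n \<omega> $ k - (\<Sum>i<n. \<eta> (V (Suc i) \<omega>) $ k) / sqrt (real n) = (?A \<omega> * ?B \<omega> - ?C \<omega>) / ?d" for \<omega>
      proof -
        have "(\<Sum>i<n. \<eta> (V (Suc i) \<omega>) $ k) = - ?C \<omega>"
          by (simp add: \<eta>_def sum_negf sum.atLeast1_atMost_eq)
        moreover have "Z n \<omega> $ k = sqrt (real n) * ((?A \<omega> * ?B \<omega> / real n - ?C \<omega>) / (real n - 1))"
          using T_stat_centered[OF n, of "\<lambda>i. Xs i \<omega>" "\<lambda>i. Rs i \<omega>" ?u ?v "mx ?u" "mr ?v"]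
          by (simp add: Z_def f_def g_def V_def)
        moreover have "sqrt (real n) * ((a / real n - c) / (real n - 1)) - - c / sqrt (real n) = (a - c) / ?d" for a c
        proof -
          define q where "q = sqrt (real n)"
          have q: "q > 0" "real n = q * q" "q * q - 1 \<noteq> 0" using n by (simp_all add: q_def)
          show ?thesis unfolding q_def[symmetric] q(2) using q(1,3) by (simp add: divide_simps) (simp add: algebra_simps)
        qed
        ultimately show ?thesis by simp
      qed
      have le: "\<bar>(?A \<omega> * ?B \<omega> - ?C \<omega>) / ?d\<bar> \<le> ?D \<omega> / ?d" for \<omega>
      proof -
        have "\<bar>?C \<omega>\<bar> \<le> (\<Sum>i=1..n. (f ?u (V i \<omega>))\<^sup>2 + (g ?v (V i \<omega>))\<^sup>2)"
          by (rule order_trans[OF sum_abs]) (intro sum_mono abs_mult_le_sum_squares)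
        then have "\<bar>?A \<omega> * ?B \<omega> - ?C \<omega>\<bar> \<le> ?D \<omega>"
          using abs_mult_le_sum_squares[of "?A \<omega>" "?B \<omega>"] by linarith
        then show ?thesis using d by (simp add: abs_divide divide_right_mono del: sum.distrib)
      qed
      have "integrable M (\<lambda>\<omega>. ?D \<omega> / ?d)"
        using fsum gsum by (simp add: sum.distrib)
      then have "M.expectation (\<lambda>\<omega>. \<bar>(?A \<omega> * ?B \<omega> - ?C \<omega>) / ?d\<bar>) \<le> M.expectation (\<lambda>\<omega>. ?D \<omega> / ?d)"
        by (rule integral_mono'[OF _ le order_trans[OF abs_ge_zero le]])
      also have "\<dots> = M.expectation ?D / ?d" by simp
      also have "M.expectation ?D = 2 * c * real n"
        using fsum gsum by (simp add: sum.distrib c_def algebra_simps)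
      finally show ?thesis unfolding diff by simp
    qed
    have "(\<lambda>n. real n / (sqrt (real n) * (real n - 1))) \<longlonglongrightarrow> 0"
      by real_asymp
    from tendsto_mult[OF tendsto_const this, of "2 * c"]
    have lim: "(\<lambda>n. 2 * c * (real n / (sqrt (real n) * (real n - 1)))) \<longlonglongrightarrow> 0"
      by simp
    show ?thesis
      by (rule Lim_null_comparison[OF _ lim]) (use bound in \<open>auto intro!: eventually_sequentiallyI[of 2]\<close>)
  qed
  have "\<exists>N. is_multivariate_normal 0 \<Sigma> N \<and> converges_in_distribution M Z N"
  \<comment> \<open>The limit theorem starts at index 0, hence \<open>V (Suc i)\<close>;
    \<open>\<mu>\<close> is the image under \<open>\<eta>\<close> of the common law of the
    triples.\<close>
  proof (rule M.multivariate_clt_perturbed[where \<xi> = "\<lambda>i \<omega>. \<eta> (V (Suc i) \<omega>)" and \<mu> = "distr (distr P borel U) borel \<eta>"])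
    show "M.indep_vars (\<lambda>_. borel) (\<lambda>i \<omega>. \<eta> (V (Suc i) \<omega>)) UNIV"
      by (rule M.indep_vars_compose2[OF VSuc_indep]) simp
    show "distr M borel (\<lambda>\<omega>. \<eta> (V (Suc n) \<omega>)) = distr (distr P borel U) borel \<eta>" for n
      unfolding V_distr[of "Suc n", simplified, symmetric]
      by (subst distr_distr) (simp_all add: V comp_def)
    show "integrable M (\<lambda>\<omega>. (\<eta> (V (Suc n) \<omega>) $ k)\<^sup>2)" for n k
      using transfer(1)[of "Suc n" "\<lambda>z. (\<eta> z $ k)\<^sup>2"] \<eta>_sq by simp
    show "M.expectation (\<lambda>\<omega>. \<eta> (V (Suc n) \<omega>) $ k) = 0" for n k
      using transfer(2)[of "Suc n" "\<lambda>z. \<eta> z $ k"] \<eta>_mean by simp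
    show "M.expectation (\<lambda>\<omega>. \<eta> (V (Suc n) \<omega>) $ k * \<eta> (V (Suc n) \<omega>) $ l) = \<Sigma> $ k $ l" for n k l
      using transfer(2)[of "Suc n" "\<lambda>z. \<eta> z $ k * \<eta> z $ l"] \<eta>_cov by simp
  qed (fact Z_meas Z_int near)+
  then show ?thesis
    unfolding \<Sigma>_def Z_def[abs_def] .
qed

end
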